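(* Fix $p,\gamma\in\mathbb{R}$ with $p\ne 0$, $\gamma\neq -1$ and $\gamma+1-\frac1p\neq 0$. Let $(P_pf)(t)=t^{-1/p}\int_0^t f(s)s^{\frac1p-1}\,ds$, $t\in\mathbb{R}_+$. Suppose that $\Phi_1$ and $\Phi_2$ are nonnegative, nondecreasing functions from $\mathbb{R}_+$ onto itself. Then the following are equivalent: (G) there is $L>0$, independent of $f$, such that $\rho_{\Phi_1,t^{\gamma}}(P_pf)\le L\,\rho_{\Phi_2,t^{\gamma}}(f)$ for all $0\le f\in M(\mathbb{R}_+)$; (M) there is $K>0$, independent of $f$, such that $$\int_{\mathbb{R}_+}\Phi_1\big((P_pf)(t)\big)t^{\gamma}\,dt\le K\int_{\mathbb{R}_+}\Phi_2\big(Kf(s)\big)s^{\gamma}\,ds\qquad\text{for all } 0\le f\in M(\mathbb{R}_+).$$ Further, if $\Phi_1$ and $\Phi_2$ are $s$-convex for some $s$, $0<s\le 1$, then (G) and (M) are equivalent to (I) $P_p:L_{\Phi_2,t^{\gamma}}(\mathbb{R}_+)\to L_{\Phi_1,t^{\gamma}}(\mathbb{R}_+)$, this mapping being continuous with respect to the metrics defined in terms of $\rho^{(s)}_{\Phi_2,t^\gamma}$ and $\rho^{(s)}_{\Phi_1,t^\gamma}$. Finally, for a general nondecreasing function $\Phi_1$ (from $\mathbb{R}_+$ onto itself) and a Young function $\Phi_2(t)=\int_0^t\phi_2(s)\,ds$ with complementary function $\Psi_2$, (G) and (M) are equivalent to (BK) there is $C>0$, independent of $t$, such that for all $t\in\mathbb{R}_+$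 $$\int_0^t\Psi_2\Big(\frac{\alpha(t)}{C\,s^{1-\frac1p+\gamma}}\Big)s^{\gamma}\,ds\le\alpha(t)=\int_t^{\infty}\Phi_1\big(s^{-\frac1p}\big)s^{\gamma}\,ds<\infty,$$ or, equivalently, there is $C>0$, independent of $t$, such that for all $t\in\mathbb{R}_+$, with the same $\alpha(t)<\infty$, $$\int_0^t\phi_2^{-1}\Big(\frac{\alpha(t)}{C\,s^{1-\frac1p+\gamma}}\Big)s^{\frac1p-1}\,ds\le C.$$
   Context: $\mathbb{R}_+=(0,\infty)$; $M(\mathbb{R}_+)$ is the class of Lebesgue-measurable functions on $\mathbb{R}_+$. For a nondecreasing function $\Phi$ from $\mathbb{R}_+$ onto itself (with $\Phi(0)=0$), the Orlicz class is $$L_{\Phi,t^{\gamma}}(\mathbb{R}_+)=\Big\{f\in M(\mathbb{R}_+):\int_{\mathbb{R}_+}\Phi(k|f(t)|)t^{\gamma}dt<\infty\text{ for some }k\in\mathbb{R}_+\Big\},$$ and the gauge ($F$-norm) is $$\rho_{\Phi,t^{\gamma}}(f)=\inf\Big\{\lambda>0:\int_{\mathbb{R}_+}\Phi\Big(\frac{|f(t)|}{\lambda}\Big)\frac{t^{\gamma}}{\lambda}\,dt\le1\Big\}.$$ $\Phi$ is $s$-convex ($0<s\le1$) if $\Phi(\alpha x+\beta y)\le\alpha^s\Phi(x)+\beta^s\Phi(y)$ for all $\alpha,\beta,x,y\in\mathbb{R}_+$ with $\alpha^s+\beta^s=1$. For $s$-convex $\Phi$, $$\rho^{(s)}_{\Phi,t^{\gamma}}(f)=\inf\Big\{\lambda>0:\int_{\mathbb{R}_+}\Phi\Big(\frac{|f(t)|}{\lambda^{1/s}}\Big)t^{\gamma}\,dt\le1\Big\},$$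 and the associated metric on $L_{\Phi,t^\gamma}(\mathbb{R}_+)$ is $(f,g)\mapsto\rho^{(s)}_{\Phi,t^\gamma}(f-g)$. A Young function is a function $\Phi(t)=\int_0^t\phi(s)\,ds$, $t\in\mathbb{R}_+$, where $\phi$ is nonnegative and nondecreasing on $\mathbb{R}_+$ with $\phi(0^+)=0$ and $\lim_{s\to\infty}\phi(s)=\infty$. Its complementary function is $\Psi(t)=\int_0^t\phi^{-1}(s)\,ds$, where $\phi^{-1}$ is the inverse of $\phi$ (the generalized inverse $\phi^{-1}(s)=\sup\{r>0:\phi(r)\le s\}$ if $\phi$ is not a bijection). *)

theory Defs
  imports "HOL-Analysis.Analysis"
begin

definition growth_function :: "(real \<Rightarrow> real) \<Rightarrow> bool" where
  "growth_function \<Phi> \<longleftrightarrow> \<Phi> 0 = 0 \<and> mono_on {0<..} \<Phi> \<and> \<Phi> ` {0<..} = {0<..}"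

definition s_convex :: "real \<Rightarrow> (real \<Rightarrow> real) \<Rightarrow> bool" where
  "s_convex s \<Phi> \<longleftrightarrow>
    (\<forall>\<alpha> \<beta> x y. \<alpha> > 0 \<longrightarrow> \<beta> > 0 \<longrightarrow> x > 0 \<longrightarrow> y > 0 \<longrightarrow> \<alpha> powr s + \<beta> powr s = 1 \<longrightarrow>
      \<Phi> (\<alpha> * x + \<beta> * y) \<le> \<alpha> powr s * \<Phi> x + \<beta> powr s * \<Phi> y)"

definition measurable_Rplus :: "(real \<Rightarrow> real) \<Rightarrow> bool" where
  "measurable_Rplus f \<longleftrightarrow> f \<in> borel_measurable (lebesgue_on {0<..})"

text \<open>For a nonnegative function the Hardy average may be infinite at some points.
  The functions \<open>\<Phi>\<close> are therefore extended to the value \<open>\<infinity>\<close> by \<open>\<Phi>(\<infinity>) = \<infinity>\<close>.\<close>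

definition extend_top :: "(real \<Rightarrow> real) \<Rightarrow> ennreal \<Rightarrow> ennreal" where
  "extend_top \<Phi> x = (if x = \<infinity> then \<infinity> else ennreal (\<Phi> (enn2real x)))"

text \<open>The argument \<open>u\<close> of the modular and of the gauge is the modulus \<open>|f|\<close>.
  The gauge is \<open>\<infinity>\<close> (infimum of the empty set) if no \<open>\<lambda>\<close> is admissible.\<close>

definition modular :: "(real \<Rightarrow> real) \<Rightarrow> real \<Rightarrow> (real \<Rightarrow> ennreal) \<Rightarrow> ennreal" where
  "modular \<Phi> \<gamma> u = (\<integral>\<^sup>+t\<in>{0<..}. extend_top \<Phi> (u t) * ennreal (t powr \<gamma>) \<partial>lebesgue)"

definition gauge_F :: "(real \<Rightarrow> real) \<Rightarrow> real \<Rightarrow> (real \<Rightarrow> ennreal) \<Rightarrow> ennreal" where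
  "gauge_F \<Phi> \<gamma> u =
    Inf {ennreal l | l. l > 0 \<and>
      (\<integral>\<^sup>+t\<in>{0<..}. extend_top \<Phi> (u t / ennreal l) * ennreal (t powr \<gamma> / l) \<partial>lebesgue) \<le> 1}"

definition gauge_s :: "real \<Rightarrow> (real \<Rightarrow> real) \<Rightarrow> real \<Rightarrow> (real \<Rightarrow> real) \<Rightarrow> ennreal" where
  "gauge_s s \<Phi> \<gamma> f =
    Inf {ennreal l | l. l > 0 \<and>
      (\<integral>\<^sup>+t\<in>{0<..}. ennreal (\<Phi> (\<bar>f t\<bar> / l powr (1 / s)) * t powr \<gamma>) \<partial>lebesgue) \<le> 1}"

definition orlicz_class :: "(real \<Rightarrow> real) \<Rightarrow> real \<Rightarrow> (real \<Rightarrow> real) set" where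
  "orlicz_class \<Phi> \<gamma> =
    {f. measurable_Rplus f \<and>
      (\<exists>k>0. (\<integral>\<^sup>+t\<in>{0<..}. ennreal (\<Phi> (k * \<bar>f t\<bar>) * t powr \<gamma>) \<partial>lebesgue) < \<infinity>)}"

text \<open>The operator \<open>P\<^sub>p\<close>, first on nonnegative functions (with values in \<open>[0,\<infinity>]\<close>) and then
  on signed functions, where the integral has to converge absolutely.\<close>

definition hardy_nn :: "real \<Rightarrow> (real \<Rightarrow> real) \<Rightarrow> real \<Rightarrow> ennreal" where
  "hardy_nn p f t =
    ennreal (t powr (- 1 / p)) * (\<integral>\<^sup>+s\<in>{0<..<t}. ennreal (f s * s powr (1 / p - 1)) \<partial>lebesgue)"

definition hardy_defined :: "real \<Rightarrow> (real \<Rightarrow> real) \<Rightarrow> bool" where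
  "hardy_defined p f \<longleftrightarrow>
    (\<forall>t>0. set_integrable lebesgue {0<..<t} (\<lambda>s. f s * s powr (1 / p - 1)))"

definition hardy :: "real \<Rightarrow> (real \<Rightarrow> real) \<Rightarrow> real \<Rightarrow> real" where
  "hardy p f t = t powr (- 1 / p) * (LINT s:{0<..<t}|lebesgue. f s * s powr (1 / p - 1))"

definition gauge_inequality ::
    "real \<Rightarrow> real \<Rightarrow> (real \<Rightarrow> real) \<Rightarrow> (real \<Rightarrow> real) \<Rightarrow> bool" where
  "gauge_inequality p \<gamma> \<Phi>1 \<Phi>2 \<longleftrightarrow>
    (\<exists>L>0. \<forall>f. measurable_Rplus f \<longrightarrow> (\<forall>t>0. 0 \<le> f t) \<longrightarrow>
      gauge_F \<Phi>1 \<gamma> (hardy_nn p f) \<le> ennreal L * gauge_F \<Phi>2 \<gamma> (\<lambda>t. ennreal (f t)))"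

definition modular_inequality ::
    "real \<Rightarrow> real \<Rightarrow> (real \<Rightarrow> real) \<Rightarrow> (real \<Rightarrow> real) \<Rightarrow> bool" where
  "modular_inequality p \<gamma> \<Phi>1 \<Phi>2 \<longleftrightarrow>
    (\<exists>K>0. \<forall>f. measurable_Rplus f \<longrightarrow> (\<forall>t>0. 0 \<le> f t) \<longrightarrow>
      modular \<Phi>1 \<gamma> (hardy_nn p f) \<le> ennreal K * modular \<Phi>2 \<gamma> (\<lambda>s. ennreal (K * f s)))"

definition hardy_maps_continuously ::
    "real \<Rightarrow> real \<Rightarrow> real \<Rightarrow> (real \<Rightarrow> real) \<Rightarrow> (real \<Rightarrow> real) \<Rightarrow> bool" where
  "hardy_maps_continuously s p \<gamma> \<Phi>1 \<Phi>2 \<longleftrightarrow>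
    (\<forall>f\<in>orlicz_class \<Phi>2 \<gamma>. hardy_defined p f \<and> hardy p f \<in> orlicz_class \<Phi>1 \<gamma>) \<and>
    (\<forall>f\<in>orlicz_class \<Phi>2 \<gamma>. \<forall>\<epsilon>>0. \<exists>\<delta>>0. \<forall>g\<in>orlicz_class \<Phi>2 \<gamma>.
      gauge_s s \<Phi>2 \<gamma> (\<lambda>t. f t - g t) < ennreal \<delta> \<longrightarrow>
      gauge_s s \<Phi>1 \<gamma> (\<lambda>t. hardy p f t - hardy p g t) < ennreal \<epsilon>)"

definition young_density :: "(real \<Rightarrow> real) \<Rightarrow> bool" where
  "young_density \<phi> \<longleftrightarrow>
    (\<forall>s>0. 0 \<le> \<phi> s) \<and> mono_on {0<..} \<phi> \<and>
    (\<phi> \<longlongrightarrow> 0) (at_right 0) \<and> filterlim \<phi> at_top at_top"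

definition primitive :: "(real \<Rightarrow> real) \<Rightarrow> real \<Rightarrow> real" where
  "primitive \<phi> t = (LINT s:{0<..<t}|lebesgue. \<phi> s)"

definition generalized_inverse :: "(real \<Rightarrow> real) \<Rightarrow> real \<Rightarrow> real" where
  "generalized_inverse \<phi> s = Sup {r. 0 < r \<and> \<phi> r \<le> s}"

text \<open>The generalized inverse is the usual inverse when \<open>\<phi>\<close> is a bijection.\<close>

lemma generalized_inverse_bij:
  assumes "mono_on {0<..} \<phi>" and "bij_betw \<phi> {0<..} {0<..}" and "r > 0"
  shows "generalized_inverse \<phi> (\<phi> r) = r"
proof -
  have "{x. 0 < x \<and> \<phi> x \<le> \<phi> r} = {0<..r}"
  proof (intro set_eqI iffI)
    fix x assume x: "x \<in> {x. 0 < x \<and> \<phi> x \<le> \<phi> r}"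
    have "x \<le> r"
    proof (rule ccontr)
      assume "\<not> x \<le> r"
      then have "\<phi> r \<le> \<phi> x"
        using assms(1,3) x by (intro mono_onD[OF assms(1)]) auto
      then have "\<phi> r = \<phi> x" using x by simp
      then have "r = x"
        using assms(2,3) x by (auto simp: bij_betw_def dest: inj_onD)
      then show False using \<open>\<not> x \<le> r\<close> by simp
    qed
    then show "x \<in> {0<..r}" using x by simp
  qed (use assms(1,3) in \<open>auto intro: mono_onD\<close>)
  then show ?thesis
    using assms(3) by (simp add: generalized_inverse_def)
qed

text \<open>\<open>young_function \<phi> \<Phi>\<close> says that \<open>\<Phi>\<close> is the Young function with density \<open>\<phi>\<close>.
  Its complementary function is \<open>complementary \<phi>\<close>.\<close>

definition young_function :: "(real \<Rightarrow> real) \<Rightarrow> (real \<Rightarrow> real) \<Rightarrow> bool" where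
  "young_function \<phi> \<Phi> \<longleftrightarrow> young_density \<phi> \<and> (\<forall>t\<ge>0. \<Phi> t = primitive \<phi> t)"

definition complementary :: "(real \<Rightarrow> real) \<Rightarrow> real \<Rightarrow> real" where
  "complementary \<phi> = primitive (generalized_inverse \<phi>)"

definition tail_alpha :: "real \<Rightarrow> real \<Rightarrow> (real \<Rightarrow> real) \<Rightarrow> real \<Rightarrow> ennreal" where
  "tail_alpha p \<gamma> \<Phi>1 t =
    (\<integral>\<^sup>+s\<in>{t<..}. ennreal (\<Phi>1 (s powr (- 1 / p)) * s powr \<gamma>) \<partial>lebesgue)"

definition bloom_kerman ::
    "real \<Rightarrow> real \<Rightarrow> (real \<Rightarrow> real) \<Rightarrow> (real \<Rightarrow> real) \<Rightarrow> bool" where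
  "bloom_kerman p \<gamma> \<Phi>1 \<phi>2 \<longleftrightarrow>
    (\<exists>C>0. \<forall>t>0.
      (\<integral>\<^sup>+s\<in>{0<..<t}. ennreal (complementary \<phi>2
          (enn2real (tail_alpha p \<gamma> \<Phi>1 t) / (C * s powr (1 - 1 / p + \<gamma>))) * s powr \<gamma>) \<partial>lebesgue)
        \<le> tail_alpha p \<gamma> \<Phi>1 t \<and>
      tail_alpha p \<gamma> \<Phi>1 t < \<infinity>)"

definition bloom_kerman_density ::
    "real \<Rightarrow> real \<Rightarrow> (real \<Rightarrow> real) \<Rightarrow> (real \<Rightarrow> real) \<Rightarrow> bool" where
  "bloom_kerman_density p \<gamma> \<Phi>1 \<phi>2 \<longleftrightarrow>
    (\<exists>C>0. \<forall>t>0.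
      (\<integral>\<^sup>+s\<in>{0<..<t}. ennreal (generalized_inverse \<phi>2
          (enn2real (tail_alpha p \<gamma> \<Phi>1 t) / (C * s powr (1 - 1 / p + \<gamma>))) * s powr (1 / p - 1))
          \<partial>lebesgue)
        \<le> ennreal C \<and>
      tail_alpha p \<gamma> \<Phi>1 t < \<infinity>)"

end

theory Submission
  imports Defs
begin

text \<open>
  Everything rests on one symmetry: \<open>P\<^sub>p\<close> commutes with the dilations
  \<open>f \<mapsto> f(c \<cdot>)\<close>, while the modular \<open>\<integral> \<Phi>(|f|) t\<^sup>\<gamma> dt\<close> is multiplied by
  \<open>c\<close> to the power \<open>- (\<gamma> + 1)\<close>, which takes every positive value because \<open>\<gamma> \<noteq> -1\<close>.
  Hence any bound for \<open>P\<^sub>p\<close> on the modular unit ball, however it arises, is already a modular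
  inequality for all \<open>f\<close> (lemma \<open>modular_inequality_of_unit_ball\<close>). The gauge inequality gives
  such a bound by definition of the gauge, and continuity at \<open>0\<close> gives one when the functions are
  \<open>s\<close>-convex. The converse implications are direct: inserting \<open>f / (K l)\<close> in the modular inequality
  gives the gauge inequality with \<open>L = K\<close>, and \<open>s\<close>-convexity, in the form
  \<open>\<Phi>(a x) \<le> a\<^sup>s \<Phi>(x)\<close>, turns a modular bound \<open>K\<close> into a modular bound \<open>1\<close>.

  For a Young function \<open>\<Phi>\<^sub>2\<close> with density \<open>\<phi>\<close>, let \<open>\<psi>\<close> be the generalized inverse of \<open>\<phi>\<close>.
  The two integral conditions are equivalent because the complementary function \<open>\<Psi>\<close> satisfies
  \<open>\<Psi>(b) \<le> b \<psi>(b) \<le> \<Psi>(2 b)\<close>. The density condition follows from the modular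
  inequality by testing the latter on multiples of \<open>s \<mapsto> \<psi>(b(s))\<close>, where \<open>b\<close> is the argument of
  \<open>\<psi>\<close> in the condition: this is the function at which Young's inequality is sharp.

  For the converse, the density condition first yields a weak type estimate: if the integral
  \<open>F(t)\<close> of \<open>f(s) s\<^bsup>1/p-1\<^esup>\<close> over \<open>(0,t)\<close> is at least \<open>1\<close>, then \<open>\<alpha>(t)\<close>
  is bounded by the modular of a multiple of \<open>f\<close> over \<open>(0,t)\<close>. Dilating replaces the level \<open>1\<close> by
  an arbitrary level. The strong inequality is then obtained by cutting the half line where \<open>F\<close>
  passes the powers of \<open>2\<close>: on the piece where \<open>2\<^sup>k < F \<le> 2\<^sup>k\<^sup>+\<^sup>1\<close> the weak type estimate is
  applied to \<open>4 f\<close> restricted to the preceding piece, whose integral is exactly large enough, and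
  the pieces add up without overlap.
\<close>

section \<open>The half line, dilations and the modular\<close>

abbreviation leb_pos :: "real measure" where
  "leb_pos \<equiv> lebesgue_on {0<..}"

lemma set_nn_integral_leb_pos:
  assumes "A \<subseteq> {0<..}"
  shows "(\<integral>\<^sup>+s\<in>A. g s \<partial>lebesgue) = (\<integral>\<^sup>+s\<in>A. g s \<partial>leb_pos)"
proof -
  have "(\<integral>\<^sup>+s\<in>A. g s \<partial>leb_pos) = (\<integral>\<^sup>+s. g s * indicator A s * indicator {0<..} s \<partial>lebesgue)"
    by (simp add: nn_integral_restrict_space)
  also have "\<dots> = (\<integral>\<^sup>+s\<in>A. g s \<partial>lebesgue)"
    using assms by (intro nn_integral_cong) (auto split: split_indicator)
  finally show ?thesis by simp
qed

lemma borel_imp_leb_pos: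
  "f \<in> borel_measurable borel \<Longrightarrow> f \<in> borel_measurable leb_pos"
  by (intro measurable_restrict_space1 measurable_completion) simp

lemma id_leb_pos [measurable]: "(\<lambda>x. x) \<in> borel_measurable leb_pos"
  by (rule borel_imp_leb_pos) simp

lemma borel_set_leb_pos:
  "A \<in> sets borel \<Longrightarrow> A \<subseteq> {0<..} \<Longrightarrow> A \<in> sets leb_pos"
  by (auto simp: sets_restrict_space_iff)

lemma measurable_Rplus_iff: "measurable_Rplus f \<longleftrightarrow> f \<in> borel_measurable leb_pos"
  by (simp add: measurable_Rplus_def)

lemma measurable_dilate:
  assumes g: "g \<in> measurable leb_pos N" and c: "c > 0"
  shows "(\<lambda>x. g (c * x)) \<in> measurable leb_pos N"
proof -
  have "(\<lambda>x. c * x) \<in> measurable lebesgue lebesgue"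
    using lebesgue_measurable_scaling[of c, where 'a=real] by (simp add: scaleR_conv_of_real[abs_def])
  then have "(\<lambda>x. c * x) \<in> measurable leb_pos leb_pos"
    using c by (intro measurable_restrict_space2 measurable_restrict_space1) (auto simp: space_restrict_space)
  from measurable_compose[OF this g] show ?thesis .
qed

lemma nn_integral_dilate:
  assumes g: "g \<in> borel_measurable leb_pos" and c: "c > 0"
  shows "(\<integral>\<^sup>+x. g x \<partial>leb_pos) = ennreal c * (\<integral>\<^sup>+x. g (c * x) \<partial>leb_pos)"
proof -
  have m: "(\<lambda>x. g x * indicator {0<..} x) \<in> borel_measurable lebesgue"
    using g by (subst (asm) borel_measurable_restrict_space_iff_ennreal) auto
  have "(\<integral>\<^sup>+x. g x \<partial>leb_pos) = (\<integral>\<^sup>+x. g x * indicator {0<..} x \<partial>lebesgue)"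
    by (simp add: nn_integral_restrict_space)
  also have "\<dots> = ennreal c * (\<integral>\<^sup>+x. g (c * x) * indicator {0<..} (c * x) \<partial>lebesgue)"
    using nn_integral_real_affine_lebesgue[OF m, of c 0] c by simp
  also have "(\<integral>\<^sup>+x. g (c * x) * indicator {0<..} (c * x) \<partial>lebesgue) =
      (\<integral>\<^sup>+x. g (c * x) * indicator {0<..} x \<partial>lebesgue)"
    using c by (intro nn_integral_cong) (auto split: split_indicator simp: zero_less_mult_iff)
  also have "\<dots> = (\<integral>\<^sup>+x. g (c * x) \<partial>leb_pos)"
    by (simp add: nn_integral_restrict_space)
  finally show ?thesis .
qed

lemma extend_top_ennreal: "0 \<le> x \<Longrightarrow> extend_top \<Phi> (ennreal x) = ennreal (\<Phi> x)"
  by (simp add: extend_top_def)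

lemma extend_top_mono:
  assumes "mono_on {0..} \<Phi>" and "x \<le> y"
  shows "extend_top \<Phi> x \<le> extend_top \<Phi> y"
proof (cases "y = \<infinity>")
  case False
  then have "enn2real x \<le> enn2real y" "x \<noteq> \<infinity>"
    using assms(2) by (auto intro!: enn2real_mono simp: top.not_eq_extremum top_unique)
  then show ?thesis using False assms(1)
    by (auto simp: extend_top_def intro!: ennreal_leI mono_onD[OF assms(1)])
qed (simp add: extend_top_def)

lemma extend_top_measurable [measurable (raw)]:
  assumes "mono_on {0..} \<Phi>" and u: "u \<in> borel_measurable M"
  shows "(\<lambda>x. extend_top \<Phi> (u x)) \<in> borel_measurable M"
proof -
  have "mono (\<lambda>x. \<Phi> (max 0 x))"
    using assms(1) by (auto intro!: monoI mono_onD[OF assms(1)])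
  then have [measurable]: "(\<lambda>x. \<Phi> (max 0 x)) \<in> borel_measurable borel"
    by (rule borel_measurable_mono)
  note u [measurable]
  have "(\<lambda>x. if u x = \<infinity> then \<infinity> else ennreal (\<Phi> (max 0 (enn2real (u x))))) \<in> borel_measurable M"
    by measurable
  then show ?thesis by (simp add: extend_top_def max_absorb2 cong: if_cong)
qed

lemma growth_function_mono:
  assumes "growth_function \<Phi>"
  shows "mono_on {0..} \<Phi>" and "\<Phi> 0 = 0" and "\<And>x. 0 \<le> x \<Longrightarrow> 0 \<le> \<Phi> x"
    and "\<And>x. 0 < x \<Longrightarrow> 0 < \<Phi> x"
proof -
  show pos: "\<And>x. 0 < x \<Longrightarrow> 0 < \<Phi> x" and z: "\<Phi> 0 = 0"
    using assms by (auto simp: growth_function_def)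
  show nn: "0 \<le> \<Phi> x" if "0 \<le> x" for x using pos[of x] z that by (cases "x = 0") auto
  show "mono_on {0..} \<Phi>"
  proof (rule mono_onI)
    fix r s :: real assume "r \<in> {0..}" "s \<in> {0..}" "r \<le> s"
    then show "\<Phi> r \<le> \<Phi> s"
      using assms z nn[of s] by (cases "r = 0") (auto simp: growth_function_def mono_on_def)
  qed
qed

definition hardy_integral :: "real \<Rightarrow> (real \<Rightarrow> real) \<Rightarrow> real \<Rightarrow> ennreal" where
  "hardy_integral p f t = (\<integral>\<^sup>+s\<in>{0<..<t}. ennreal (f s * s powr (1 / p - 1)) \<partial>leb_pos)"

lemma hardy_nn_hardy_integral: "hardy_nn p f t = ennreal (t powr (- 1 / p)) * hardy_integral p f t"
  unfolding hardy_nn_def hardy_integral_def by (subst set_nn_integral_leb_pos) auto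

lemma hardy_integral_mono_upper: "s \<le> t \<Longrightarrow> hardy_integral p f s \<le> hardy_integral p f t"
  unfolding hardy_integral_def by (intro nn_integral_mono) (auto split: split_indicator)

lemma hardy_integral_mono:
  assumes "\<And>s. 0 < s \<Longrightarrow> f s \<le> g s"
  shows "hardy_integral p f t \<le> hardy_integral p g t"
  unfolding hardy_integral_def using assms
  by (intro nn_integral_mono) (auto split: split_indicator simp: space_restrict_space intro!: ennreal_leI mult_right_mono)

lemma hardy_integral_cmult:
  assumes [measurable]: "f \<in> borel_measurable leb_pos" and "0 \<le> c"
  shows "hardy_integral p (\<lambda>s. c * f s) t = ennreal c * hardy_integral p f t"
  unfolding hardy_integral_def using assms(2)
  by (subst nn_integral_cmult[symmetric]) (auto simp: ennreal_mult' mult.assoc)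

text \<open>Superlevel sets of a monotone function are intervals.\<close>

lemma borel_measurable_mono_ennreal:
  fixes F :: "real \<Rightarrow> ennreal"
  assumes "mono F"
  shows "F \<in> borel_measurable borel"
proof (rule borel_measurableI_greater)
  fix y
  have "is_interval {x. y < F x}"
    unfolding is_interval_1 using monoD[OF assms] by (auto intro: less_le_trans)
  then have "{x. y < F x} \<in> sets borel"
    by (rule real_interval_borel_measurable)
  then show "{x \<in> space borel. y < F x} \<in> sets borel" by simp
qed

lemma hardy_nn_measurable [measurable]: "hardy_nn p f \<in> borel_measurable leb_pos"
proof -
  have [measurable]: "hardy_integral p f \<in> borel_measurable borel"
    by (intro borel_measurable_mono_ennreal monoI hardy_integral_mono_upper)
  show ?thesis unfolding hardy_nn_hardy_integral[abs_def] by measurable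
qed

lemma hardy_nn_cmult:
  assumes "f \<in> borel_measurable leb_pos" and "0 \<le> c"
  shows "hardy_nn p (\<lambda>s. c * f s) t = ennreal c * hardy_nn p f t"
  using assms by (simp add: hardy_nn_hardy_integral hardy_integral_cmult mult_ac)

lemma modular_leb_pos:
  "modular \<Phi> \<gamma> u = (\<integral>\<^sup>+t. extend_top \<Phi> (u t) * ennreal (t powr \<gamma>) \<partial>leb_pos)"
  unfolding modular_def by (simp add: nn_integral_restrict_space)

lemma modular_mono:
  assumes "mono_on {0..} \<Phi>" and "\<And>t. 0 < t \<Longrightarrow> u t \<le> v t"
  shows "modular \<Phi> \<gamma> u \<le> modular \<Phi> \<gamma> v"
  unfolding modular_leb_pos using assms
  by (intro nn_integral_mono mult_right_mono extend_top_mono) (auto simp: space_restrict_space)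

lemma modular_cong:
  assumes "\<And>t. 0 < t \<Longrightarrow> u t = v t"
  shows "modular \<Phi> \<gamma> u = modular \<Phi> \<gamma> v"
  unfolding modular_leb_pos using assms
  by (intro nn_integral_cong) (auto simp: space_restrict_space)

text \<open>The substitution \<open>t \<mapsto> c t\<close>. The exponent \<open>\<gamma> + 1\<close> combines the weight with the
  Lebesgue measure; that it does not vanish is what makes dilations useful below.\<close>

lemma modular_dilate:
  assumes \<Phi>: "mono_on {0..} \<Phi>" and u[measurable]: "u \<in> borel_measurable leb_pos" and c: "c > 0"
  shows "modular \<Phi> \<gamma> u = ennreal (c powr (\<gamma> + 1)) * modular \<Phi> \<gamma> (\<lambda>t. u (c * t))"
proof -
  note measurable_dilate[OF u c, measurable] \<Phi>[measurable]
  have "modular \<Phi> \<gamma> u =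
      ennreal c * (\<integral>\<^sup>+t. extend_top \<Phi> (u (c * t)) * ennreal ((c * t) powr \<gamma>) \<partial>leb_pos)"
    unfolding modular_leb_pos by (rule nn_integral_dilate[OF _ c]) measurable
  also have "(\<integral>\<^sup>+t. extend_top \<Phi> (u (c * t)) * ennreal ((c * t) powr \<gamma>) \<partial>leb_pos) =
      (\<integral>\<^sup>+t. ennreal (c powr \<gamma>) * (extend_top \<Phi> (u (c * t)) * ennreal (t powr \<gamma>)) \<partial>leb_pos)"
    using c by (intro nn_integral_cong)
      (auto simp: space_restrict_space powr_mult ennreal_mult' mult_ac)
  also have "\<dots> = ennreal (c powr \<gamma>) * modular \<Phi> \<gamma> (\<lambda>t. u (c * t))"
    unfolding modular_leb_pos by (rule nn_integral_cmult) measurable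
  finally show ?thesis using c
    by (simp add: powr_add mult.assoc[symmetric] ennreal_mult'[symmetric] mult.commute)
qed

lemma hardy_integral_dilate:
  assumes f[measurable]: "f \<in> borel_measurable leb_pos" and c: "c > 0" and t: "t > 0"
  shows "hardy_integral p f (c * t) = ennreal (c powr (1 / p)) * hardy_integral p (\<lambda>s. f (c * s)) t"
proof -
  note measurable_dilate[OF f c, measurable]
  have "hardy_integral p f (c * t) = ennreal c *
      (\<integral>\<^sup>+s. ennreal (f (c * s) * (c * s) powr (1 / p - 1)) * indicator {0<..<c * t} (c * s) \<partial>leb_pos)"
    unfolding hardy_integral_def by (rule nn_integral_dilate[OF _ c]) measurable
  also have "(\<integral>\<^sup>+s. ennreal (f (c * s) * (c * s) powr (1 / p - 1)) * indicator {0<..<c * t} (c * s) \<partial>leb_pos)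
      = (\<integral>\<^sup>+s. ennreal (c powr (1 / p - 1)) *
          (ennreal (f (c * s) * s powr (1 / p - 1)) * indicator {0<..<t} s) \<partial>leb_pos)"
    using c by (intro nn_integral_cong)
      (auto simp: space_restrict_space powr_mult ennreal_mult'[symmetric] mult_ac split: split_indicator)
  also have "\<dots> = ennreal (c powr (1 / p - 1)) * hardy_integral p (\<lambda>s. f (c * s)) t"
    unfolding hardy_integral_def by (rule nn_integral_cmult) measurable
  also have "ennreal c * (ennreal (c powr (1 / p - 1)) * hardy_integral p (\<lambda>s. f (c * s)) t) =
     ennreal (c powr (1 / p)) * hardy_integral p (\<lambda>s. f (c * s)) t"
    using c by (simp add: powr_diff mult.assoc[symmetric] ennreal_mult'[symmetric])
  finally show ?thesis .
qed

lemma hardy_nn_dilate: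
  assumes f: "f \<in> borel_measurable leb_pos" and c: "c > 0" and t: "t > 0"
  shows "hardy_nn p (\<lambda>s. f (c * s)) t = hardy_nn p f (c * t)"
proof -
  have "hardy_nn p f (c * t) =
      ennreal ((c * t) powr (-1 / p) * c powr (1 / p)) * hardy_integral p (\<lambda>s. f (c * s)) t"
    using c by (simp add: hardy_nn_hardy_integral hardy_integral_dilate[OF f c t] ennreal_mult' mult.assoc)
  also have "(c * t) powr (-1 / p) * c powr (1 / p) = t powr (-1 / p)"
    using c t by (simp add: powr_mult powr_minus field_simps)
  finally show ?thesis by (simp add: hardy_nn_hardy_integral)
qed

section \<open>The gauge inequality and the modular inequality\<close>

lemma divide_ennreal_pos: "0 < c \<Longrightarrow> x / ennreal c = ennreal (1 / c) * x"
  by (simp add: divide_ennreal_def inverse_ennreal inverse_eq_divide mult.commute)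

text \<open>The factor \<open>1 / l\<close> in the gauge is part of the weight, so it can be moved to the other side.
  The level set of admissible \<open>l\<close> then compares a modular with \<open>l\<close>, a form in which the constant
  of a modular inequality can be absorbed into \<open>l\<close> without any convexity.\<close>

lemma gauge_F_modular:
  assumes \<Phi>: "mono_on {0..} \<Phi>" and [measurable]: "u \<in> borel_measurable leb_pos"
  shows "gauge_F \<Phi> \<gamma> u =
    Inf {ennreal l | l. l > 0 \<and> modular \<Phi> \<gamma> (\<lambda>t. u t / ennreal l) \<le> ennreal l}"
proof -
  note \<Phi>[measurable]
  have "(\<integral>\<^sup>+t\<in>{0<..}. extend_top \<Phi> (u t / ennreal l) * ennreal (t powr \<gamma> / l) \<partial>lebesgue) \<le> 1
      \<longleftrightarrow> modular \<Phi> \<gamma> (\<lambda>t. u t / ennreal l) \<le> ennreal l" if l: "l > 0" for l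
  proof -
    have "(\<integral>\<^sup>+t\<in>{0<..}. extend_top \<Phi> (u t / ennreal l) * ennreal (t powr \<gamma> / l) \<partial>lebesgue) =
        (\<integral>\<^sup>+t. (extend_top \<Phi> (u t / ennreal l) * ennreal (t powr \<gamma>)) * ennreal (1 / l) \<partial>leb_pos)"
      using l by (auto simp: nn_integral_restrict_space mult.assoc ennreal_mult'[symmetric]
          intro!: nn_integral_cong)
    also have "\<dots> = modular \<Phi> \<gamma> (\<lambda>t. u t / ennreal l) * ennreal (1 / l)"
      unfolding modular_leb_pos by (rule nn_integral_multc) measurable
    also have "\<dots> \<le> 1 \<longleftrightarrow> modular \<Phi> \<gamma> (\<lambda>t. u t / ennreal l) \<le> ennreal l"
      using l by (cases "modular \<Phi> \<gamma> (\<lambda>t. u t / ennreal l)" rule: ennreal_cases)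
        (auto simp: ennreal_mult'[symmetric] ennreal_top_mult top_unique divide_le_eq)
    finally show ?thesis .
  qed
  then show ?thesis unfolding gauge_F_def by (intro arg_cong[where f=Inf]) blast
qed

text \<open>If \<open>l\<close> is admissible for \<open>f\<close>, then \<open>K l\<close> is admissible for \<open>P\<^sub>p f\<close>: apply the modular
  inequality to \<open>f / (K l)\<close>, so that \<open>f / l\<close> appears on its right side.\<close>

lemma modular_inequality_imp_gauge_inequality:
  assumes \<Phi>1: "mono_on {0..} \<Phi>1" and \<Phi>2: "mono_on {0..} \<Phi>2"
    and M: "modular_inequality p \<gamma> \<Phi>1 \<Phi>2"
  shows "gauge_inequality p \<gamma> \<Phi>1 \<Phi>2"
proof -
  from M obtain K where K: "K > 0" and le: "\<And>f. f \<in> borel_measurable leb_pos \<Longrightarrow> \<forall>t>0. 0 \<le> f t \<Longrightarrow>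
      modular \<Phi>1 \<gamma> (hardy_nn p f) \<le> ennreal K * modular \<Phi>2 \<gamma> (\<lambda>s. ennreal (K * f s))"
    unfolding modular_inequality_def measurable_Rplus_iff by blast
  show ?thesis unfolding gauge_inequality_def measurable_Rplus_iff
  proof (intro exI[of _ K] conjI K allI impI)
    fix f :: "real \<Rightarrow> real"
    assume f[measurable]: "f \<in> borel_measurable leb_pos" and nn: "\<forall>t>0. 0 \<le> f t"
    have "gauge_F \<Phi>1 \<gamma> (hardy_nn p f) \<le> ennreal K * ennreal l"
      if l: "l > 0" and adm: "modular \<Phi>2 \<gamma> (\<lambda>t. ennreal (f t) / ennreal l) \<le> ennreal l" for l
    proof -
      have "modular \<Phi>1 \<gamma> (\<lambda>t. hardy_nn p f t / ennreal (K * l)) =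
          modular \<Phi>1 \<gamma> (hardy_nn p (\<lambda>s. 1 / (K * l) * f s))"
        using K l by (intro modular_cong) (subst hardy_nn_cmult, auto simp: divide_ennreal_pos)
      also have "\<dots> \<le> ennreal K * modular \<Phi>2 \<gamma> (\<lambda>s. ennreal (K * (1 / (K * l) * f s)))"
        using K l nn by (intro le) auto
      also have "modular \<Phi>2 \<gamma> (\<lambda>s. ennreal (K * (1 / (K * l) * f s))) =
          modular \<Phi>2 \<gamma> (\<lambda>t. ennreal (f t) / ennreal l)"
        using K l nn by (intro modular_cong) (simp add: divide_ennreal)
      also have "ennreal K * \<dots> \<le> ennreal K * ennreal l"
        by (intro mult_left_mono adm) simp
      finally have "modular \<Phi>1 \<gamma> (\<lambda>t. hardy_nn p f t / ennreal (K * l)) \<le> ennreal (K * l)"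
        using K by (simp add: ennreal_mult')
      then have "gauge_F \<Phi>1 \<gamma> (hardy_nn p f) \<le> ennreal (K * l)"
        using K l unfolding gauge_F_modular[OF \<Phi>1 hardy_nn_measurable]
        by (intro Inf_lower) auto
      then show ?thesis using K by (simp add: ennreal_mult')
    qed
    then have "gauge_F \<Phi>1 \<gamma> (hardy_nn p f) / ennreal K \<le> gauge_F \<Phi>2 \<gamma> (\<lambda>t. ennreal (f t))"
      using K by (subst gauge_F_modular[OF \<Phi>2])
        (auto intro!: Inf_greatest divide_le_posI_ennreal simp: mult.commute)
    then have "ennreal K * (gauge_F \<Phi>1 \<gamma> (hardy_nn p f) / ennreal K) \<le>
        ennreal K * gauge_F \<Phi>2 \<gamma> (\<lambda>t. ennreal (f t))"
      by (intro mult_left_mono) auto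
    also have "ennreal K * (gauge_F \<Phi>1 \<gamma> (hardy_nn p f) / ennreal K) = gauge_F \<Phi>1 \<gamma> (hardy_nn p f)"
      using K by (simp add: ennreal_times_divide mult.commute[of "ennreal K"] ennreal_mult_divide_eq)
    finally show "gauge_F \<Phi>1 \<gamma> (hardy_nn p f) \<le> ennreal K * gauge_F \<Phi>2 \<gamma> (\<lambda>t. ennreal (f t))" .
  qed
qed

text \<open>The common exit of the implications that end in the modular inequality. A function whose
  modular is at most \<open>x\<close> is dilated into the unit ball, the bound there is applied, and dilating back
  costs exactly the factor \<open>x\<close>. Taking \<open>x\<close> slightly larger than the modular also covers functions
  of modular \<open>0\<close>.\<close>

lemma modular_inequality_of_unit_ball:
  assumes "\<gamma> \<noteq> -1" and \<Phi>1: "mono_on {0..} \<Phi>1" and \<Phi>2: "mono_on {0..} \<Phi>2"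
    and c: "c > 0" and d: "d > 0"
    and ball: "\<And>f. f \<in> borel_measurable leb_pos \<Longrightarrow> \<forall>t>0. 0 \<le> f t \<Longrightarrow>
      modular \<Phi>2 \<gamma> (\<lambda>t. ennreal (f t)) \<le> 1 \<Longrightarrow>
      modular \<Phi>1 \<gamma> (\<lambda>t. ennreal c * hardy_nn p f t) \<le> ennreal d"
  shows "modular_inequality p \<gamma> \<Phi>1 \<Phi>2"
proof -
  have homogeneous: "modular \<Phi>1 \<gamma> (\<lambda>t. ennreal c * hardy_nn p f t) \<le>
      ennreal d * modular \<Phi>2 \<gamma> (\<lambda>t. ennreal (f t))"
    if f[measurable]: "f \<in> borel_measurable leb_pos" and nn: "\<forall>t>0. 0 \<le> f t" for f
  proof (rule ccontr)
    assume neg: "\<not> ?thesis"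
    define I where "I = modular \<Phi>2 \<gamma> (\<lambda>t. ennreal (f t))"
    have scaled: "modular \<Phi>1 \<gamma> (\<lambda>t. ennreal c * hardy_nn p f t) \<le> ennreal (x * d)"
      if x: "x > 0" and I: "I \<le> ennreal x" for x
    proof -
      \<comment> \<open>The dilation by \<open>a\<close> divides the modular by \<open>x\<close>.\<close>
      define a where "a = x powr (1 / (\<gamma> + 1))"
      have a: "a > 0" "a powr (\<gamma> + 1) = x"
        using x assms(1) by (auto simp: a_def powr_powr)
      have "ennreal x * modular \<Phi>2 \<gamma> (\<lambda>t. ennreal (f (a * t))) = I"
        unfolding I_def using modular_dilate[OF \<Phi>2 _ a(1), of "\<lambda>t. ennreal (f t)" \<gamma>] a(2) by simp
      then have "ennreal x * modular \<Phi>2 \<gamma> (\<lambda>t. ennreal (f (a * t))) \<le> ennreal x * 1"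
        using I by simp
      then have "modular \<Phi>2 \<gamma> (\<lambda>t. ennreal (f (a * t))) \<le> 1"
        using x by (subst (asm) ennreal_mult_le_mult_iff) auto
      then have "modular \<Phi>1 \<gamma> (\<lambda>t. ennreal c * hardy_nn p (\<lambda>s. f (a * s)) t) \<le> ennreal d"
        using nn a(1) by (intro ball measurable_dilate) auto
      also have "modular \<Phi>1 \<gamma> (\<lambda>t. ennreal c * hardy_nn p (\<lambda>s. f (a * s)) t) =
          modular \<Phi>1 \<gamma> (\<lambda>t. ennreal c * hardy_nn p f (a * t))"
        using a(1) f by (intro modular_cong) (simp add: hardy_nn_dilate)
      finally have "ennreal x * modular \<Phi>1 \<gamma> (\<lambda>t. ennreal c * hardy_nn p f (a * t)) \<le> ennreal (x * d)"
        using x by (simp add: ennreal_mult' mult_left_mono)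
      then show ?thesis
        using modular_dilate[OF \<Phi>1 _ a(1), of "\<lambda>t. ennreal c * hardy_nn p f t" \<gamma>] a(2) by simp
    qed
    have "I \<noteq> \<infinity>" using neg d by (auto simp: I_def ennreal_mult_top)
    then obtain i where i: "I = ennreal i" "0 \<le> i" by (cases I rule: ennreal_cases) auto
    have "modular \<Phi>1 \<gamma> (\<lambda>t. ennreal c * hardy_nn p f t) \<le> ennreal (d * i)"
    proof (rule ennreal_le_epsilon)
      fix e :: real assume e: "e > 0"
      have "modular \<Phi>1 \<gamma> (\<lambda>t. ennreal c * hardy_nn p f t) \<le> ennreal ((i + e / d) * d)"
        using e d i by (intro scaled ennreal_leI) (auto intro!: add_nonneg_pos ennreal_leI)
      also have "ennreal ((i + e / d) * d) = ennreal (d * i) + ennreal e"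
        using e d i(2) by (simp add: algebra_simps ennreal_plus)
      finally show "modular \<Phi>1 \<gamma> (\<lambda>t. ennreal c * hardy_nn p f t) \<le> ennreal (d * i) + ennreal e" .
    qed
    then show False using neg i d by (simp add: I_def[symmetric] ennreal_mult')
  qed
  define K where "K = max d (1 / c)"
  have K: "K > 0" "d \<le> K" "1 / c \<le> K" using d by (auto simp: K_def)
  show ?thesis unfolding modular_inequality_def measurable_Rplus_iff
  proof (intro exI[of _ K] conjI K allI impI)
    fix f :: "real \<Rightarrow> real"
    assume f[measurable]: "f \<in> borel_measurable leb_pos" and nn: "\<forall>t>0. 0 \<le> f t"
    have "modular \<Phi>1 \<gamma> (hardy_nn p f) =
        modular \<Phi>1 \<gamma> (\<lambda>t. ennreal c * hardy_nn p (\<lambda>s. 1 / c * f s) t)"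
    proof (rule modular_cong)
      fix t
      have "ennreal c * hardy_nn p (\<lambda>s. 1 / c * f s) t = ennreal c * (ennreal (1 / c) * hardy_nn p f t)"
        using c f by (subst hardy_nn_cmult) auto
      also have "\<dots> = hardy_nn p f t"
        using c by (simp only: mult.assoc[symmetric] ennreal_mult'[symmetric]) simp
      finally show "hardy_nn p f t = ennreal c * hardy_nn p (\<lambda>s. 1 / c * f s) t" by simp
    qed
    also have "\<dots> \<le> ennreal d * modular \<Phi>2 \<gamma> (\<lambda>t. ennreal (1 / c * f t))"
      using c nn by (intro homogeneous) auto
    also have "\<dots> \<le> ennreal K * modular \<Phi>2 \<gamma> (\<lambda>s. ennreal (K * f s))"
      using K nn by (intro mult_mono modular_mono[OF \<Phi>2] ennreal_leI mult_right_mono) auto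
    finally show "modular \<Phi>1 \<gamma> (hardy_nn p f) \<le> ennreal K * modular \<Phi>2 \<gamma> (\<lambda>s. ennreal (K * f s))" .
  qed
qed

text \<open>On the modular unit ball the gauge of \<open>f\<close> is at most \<open>1\<close>, hence that of \<open>P\<^sub>p f\<close> is at most
  \<open>L\<close>. The infimum need not be attained, so the admissible number is only known to be below \<open>2 L\<close>.\<close>

lemma gauge_inequality_imp_modular_inequality:
  assumes "\<gamma> \<noteq> -1" and \<Phi>1: "mono_on {0..} \<Phi>1" and \<Phi>2: "mono_on {0..} \<Phi>2"
    and G: "gauge_inequality p \<gamma> \<Phi>1 \<Phi>2"
  shows "modular_inequality p \<gamma> \<Phi>1 \<Phi>2"
proof -
  from G obtain L where L: "L > 0" and le: "\<And>f. f \<in> borel_measurable leb_pos \<Longrightarrow> \<forall>t>0. 0 \<le> f t \<Longrightarrow>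
      gauge_F \<Phi>1 \<gamma> (hardy_nn p f) \<le> ennreal L * gauge_F \<Phi>2 \<gamma> (\<lambda>t. ennreal (f t))"
    unfolding gauge_inequality_def measurable_Rplus_iff by blast
  show ?thesis
  proof (rule modular_inequality_of_unit_ball[OF assms(1-3)])
    show "1 / (2 * L) > 0" "2 * L > 0" using L by auto
    fix f :: "real \<Rightarrow> real"
    assume f[measurable]: "f \<in> borel_measurable leb_pos" and nn: "\<forall>t>0. 0 \<le> f t"
      and ball: "modular \<Phi>2 \<gamma> (\<lambda>t. ennreal (f t)) \<le> 1"
    have "gauge_F \<Phi>2 \<gamma> (\<lambda>t. ennreal (f t)) \<le> ennreal 1"
      using ball divide_ennreal_pos[of 1]
      by (subst gauge_F_modular[OF \<Phi>2]) (auto intro!: Inf_lower exI[of _ 1])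
    then have "gauge_F \<Phi>1 \<gamma> (hardy_nn p f) \<le> ennreal L"
      using le[OF f nn] mult_left_mono[of "gauge_F \<Phi>2 \<gamma> (\<lambda>t. ennreal (f t))" 1 "ennreal L"]
      by (auto intro: order_trans)
    also have "\<dots> < ennreal (2 * L)" using L by (simp add: ennreal_less_iff)
    finally obtain l where l: "l > 0" "l < 2 * L"
        "modular \<Phi>1 \<gamma> (\<lambda>t. hardy_nn p f t / ennreal l) \<le> ennreal l"
      unfolding gauge_F_modular[OF \<Phi>1 hardy_nn_measurable] Inf_less_iff
      by (auto simp: ennreal_less_iff)
    have "modular \<Phi>1 \<gamma> (\<lambda>t. ennreal (1 / (2 * L)) * hardy_nn p f t) \<le>
        modular \<Phi>1 \<gamma> (\<lambda>t. hardy_nn p f t / ennreal l)"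
    proof (rule modular_mono[OF \<Phi>1])
      fix t
      have "ennreal (1 / (2 * L)) \<le> ennreal (1 / l)" using l by (intro ennreal_leI) (simp add: frac_le)
      then show "ennreal (1 / (2 * L)) * hardy_nn p f t \<le> hardy_nn p f t / ennreal l"
        using l by (simp add: divide_ennreal_pos mult_right_mono)
    qed
    also have "\<dots> \<le> ennreal l" by (rule l)
    also have "\<dots> \<le> ennreal (2 * L)" using l by (intro ennreal_leI) auto
    finally show "modular \<Phi>1 \<gamma> (\<lambda>t. ennreal (1 / (2 * L)) * hardy_nn p f t) \<le> ennreal (2 * L)" .
  qed
qed

section \<open>Continuity of the operator for s-convex functions\<close>

text \<open>Let the second argument in the definition of \<open>s\<close>-convexity tend to \<open>0\<close>. Since \<open>\<Phi>\<close> is onto,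
  it takes arbitrarily small values, so the second term disappears in the limit.\<close>

lemma s_convex_scale:
  assumes \<Phi>: "growth_function \<Phi>" and conv: "s_convex s \<Phi>" and s: "0 < s"
    and a: "0 < a" "a \<le> 1" and x: "0 \<le> x"
  shows "\<Phi> (a * x) \<le> a powr s * \<Phi> x"
proof (cases "a = 1 \<or> x = 0")
  case True
  then show ?thesis using growth_function_mono(2)[OF \<Phi>] by auto
next
  case False
  \<comment> \<open>The partner of \<open>a\<close> in the definition of \<open>s\<close>-convexity.\<close>
  define b where "b = (1 - a powr s) powr (1 / s)"
  have as: "a powr s < 1" using powr_less_mono2[of s a 1] False a s by simp
  then have b: "b > 0" "b powr s = 1 - a powr s" using s by (auto simp: b_def powr_powr)
  show ?thesis
  proof (rule field_le_epsilon)
    fix e :: real assume e: "e > 0"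
    then have "e \<in> \<Phi> ` {0<..}"
      using \<Phi> by (simp add: growth_function_def)
    then obtain y where y: "y > 0" "\<Phi> y = e" by auto
    have "\<Phi> (a * x) \<le> \<Phi> (a * x + b * y)"
      using a b x y by (intro mono_onD[OF growth_function_mono(1)[OF \<Phi>]]) auto
    also have "\<dots> \<le> a powr s * \<Phi> x + b powr s * \<Phi> y"
      using conv[unfolded s_convex_def, rule_format, of a b x y] a b x y False by simp
    also have "b powr s * \<Phi> y \<le> 1 * e"
      using y e b a by (intro mult_mono) auto
    finally show "\<Phi> (a * x) \<le> a powr s * \<Phi> x + e" by simp
  qed
qed

lemma modular_s_convex_scale:
  assumes \<Phi>: "growth_function \<Phi>" and conv: "s_convex s \<Phi>" and s: "0 < s"
    and a: "0 < a" "a \<le> 1" and [measurable]: "u \<in> borel_measurable leb_pos"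
  shows "modular \<Phi> \<gamma> (\<lambda>t. ennreal a * u t) \<le> ennreal (a powr s) * modular \<Phi> \<gamma> u"
proof -
  note growth_function_mono(1)[OF \<Phi>, measurable]
  have "extend_top \<Phi> (ennreal a * x) \<le> ennreal (a powr s) * extend_top \<Phi> x" for x
  proof (cases x rule: ennreal_cases)
    case (real r)
    then have "extend_top \<Phi> (ennreal a * x) = ennreal (\<Phi> (a * r))"
      using a by (simp add: ennreal_mult'[symmetric] extend_top_ennreal)
    also have "\<dots> \<le> ennreal (a powr s * \<Phi> r)"
      using real a by (intro ennreal_leI s_convex_scale[OF \<Phi> conv s]) auto
    finally show ?thesis using real by (simp add: extend_top_ennreal ennreal_mult')
  qed (use a in \<open>simp add: extend_top_def ennreal_mult_top\<close>)
  then have "modular \<Phi> \<gamma> (\<lambda>t. ennreal a * u t) \<le>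
      (\<integral>\<^sup>+t. ennreal (a powr s) * (extend_top \<Phi> (u t) * ennreal (t powr \<gamma>)) \<partial>leb_pos)"
    unfolding modular_leb_pos mult.assoc[symmetric] by (intro nn_integral_mono mult_right_mono) auto
  also have "\<dots> = ennreal (a powr s) * modular \<Phi> \<gamma> u"
    unfolding modular_leb_pos by (rule nn_integral_cmult) measurable
  finally show ?thesis .
qed

lemma modular_of_nonneg:
  assumes "\<And>t. 0 < t \<Longrightarrow> 0 \<le> f t"
  shows "(\<integral>\<^sup>+t\<in>{0<..}. ennreal (\<Phi> (f t) * t powr \<gamma>) \<partial>lebesgue) = modular \<Phi> \<gamma> (\<lambda>t. ennreal (f t))"
  unfolding modular_def
  by (intro nn_integral_cong) (auto split: split_indicator simp: extend_top_ennreal assms ennreal_mult'')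

lemma orlicz_class_iff:
  "f \<in> orlicz_class \<Phi> \<gamma> \<longleftrightarrow> f \<in> borel_measurable leb_pos \<and>
    (\<exists>k>0. modular \<Phi> \<gamma> (\<lambda>t. ennreal (k * \<bar>f t\<bar>)) < \<infinity>)"
  unfolding orlicz_class_def mem_Collect_eq measurable_Rplus_iff
  by (intro conj_cong refl ex_cong) (subst modular_of_nonneg; simp)

lemma gauge_s_modular:
  "gauge_s s \<Phi> \<gamma> f =
    Inf {ennreal l | l. l > 0 \<and> modular \<Phi> \<gamma> (\<lambda>t. ennreal (\<bar>f t\<bar> / l powr (1 / s))) \<le> 1}"
  unfolding gauge_s_def by (subst modular_of_nonneg) auto

lemma hardy_integral_cong:
  assumes "\<And>s. 0 < s \<Longrightarrow> f s = g s"
  shows "hardy_integral p f t = hardy_integral p g t"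
  unfolding hardy_integral_def using assms
  by (intro nn_integral_cong) (auto simp: space_restrict_space)

lemma hardy_integrable_iff:
  assumes f[measurable]: "f \<in> borel_measurable leb_pos"
  shows "set_integrable lebesgue {0<..<t} (\<lambda>s. f s * s powr (1 / p - 1)) \<longleftrightarrow>
    hardy_integral p (\<lambda>s. \<bar>f s\<bar>) t < \<infinity>"
proof -
  have "(\<lambda>s. f s * s powr (1 / p - 1)) \<in> borel_measurable leb_pos" by measurable
  then have "(\<lambda>s. indicator {0<..} s *\<^sub>R (f s * s powr (1 / p - 1))) \<in> borel_measurable lebesgue"
    by (subst (asm) borel_measurable_restrict_space_iff) auto
  then have "(\<lambda>s. indicator {0<..<t} s * (indicator {0<..} s *\<^sub>R (f s * s powr (1 / p - 1))))
      \<in> borel_measurable lebesgue"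
    by (intro borel_measurable_times borel_measurable_indicator) auto
  also have "(\<lambda>s. indicator {0<..<t} s * (indicator {0<..} s *\<^sub>R (f s * s powr (1 / p - 1)))) =
      (\<lambda>s. indicator {0<..<t} s *\<^sub>R (f s * s powr (1 / p - 1)))"
    by (auto simp: fun_eq_iff split: split_indicator)
  finally have m: "(\<lambda>s. indicator {0<..<t} s *\<^sub>R (f s * s powr (1 / p - 1))) \<in> borel_measurable lebesgue" .
  have "(\<integral>\<^sup>+s. ennreal (norm (indicator {0<..<t} s *\<^sub>R (f s * s powr (1 / p - 1)))) \<partial>lebesgue) =
      (\<integral>\<^sup>+s\<in>{0<..<t}. ennreal (\<bar>f s\<bar> * s powr (1 / p - 1)) \<partial>lebesgue)"
    by (intro nn_integral_cong) (auto split: split_indicator simp: abs_mult)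
  also have "\<dots> = hardy_integral p (\<lambda>s. \<bar>f s\<bar>) t"
    unfolding hardy_integral_def by (rule set_nn_integral_leb_pos) auto
  finally show ?thesis unfolding set_integrable_def integrable_iff_bounded using m by simp
qed

text \<open>Since \<open>ennreal\<close> truncates at \<open>0\<close>, the two terms are the integrals of the positive and of the
  negative part.\<close>

lemma hardy_eq_hardy_integral:
  assumes "set_integrable lebesgue {0<..<t} (\<lambda>s. f s * s powr (1 / p - 1))"
  shows "hardy p f t =
    t powr (- 1 / p) * (enn2real (hardy_integral p f t) - enn2real (hardy_integral p (\<lambda>s. - f s) t))"
proof -
  have c: "(\<integral>\<^sup>+s. ennreal (indicator {0<..<t} s *\<^sub>R (g s * s powr (1 / p - 1))) \<partial>lebesgue) = hardy_integral p g t"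
    for g :: "real \<Rightarrow> real"
    unfolding hardy_integral_def by (subst set_nn_integral_leb_pos[symmetric])
      (auto intro!: nn_integral_cong split: split_indicator)
  show ?thesis
    unfolding hardy_def set_lebesgue_integral_def
    by (subst real_lebesgue_integral_def[OF assms[unfolded set_integrable_def]])
      (use c[of f] c[of "\<lambda>s. - f s"] in \<open>simp add: algebra_simps\<close>)
qed

lemma hardy_measurable:
  assumes "hardy_defined p f"
  shows "hardy p f \<in> borel_measurable leb_pos"
proof -
  have [measurable]: "hardy_integral p g \<in> borel_measurable borel" for g
    by (intro borel_measurable_mono_ennreal monoI hardy_integral_mono_upper)
  have "(\<lambda>t. t powr (- 1 / p) * (enn2real (hardy_integral p f t) - enn2real (hardy_integral p (\<lambda>s. - f s) t)))
      \<in> borel_measurable leb_pos"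
    by measurable
  then show ?thesis
    using assms by (subst measurable_cong[OF hardy_eq_hardy_integral])
      (auto simp: hardy_defined_def space_restrict_space)
qed

lemma abs_hardy_le_hardy_nn:
  assumes "f \<in> borel_measurable leb_pos" and "hardy_defined p f" and t: "t > 0"
  shows "ennreal \<bar>hardy p f t\<bar> \<le> hardy_nn p (\<lambda>s. \<bar>f s\<bar>) t"
proof -
  have int: "set_integrable lebesgue {0<..<t} (\<lambda>s. f s * s powr (1 / p - 1))"
    using assms by (simp add: hardy_defined_def)
  then have fin: "hardy_integral p (\<lambda>s. \<bar>f s\<bar>) t < \<infinity>"
    using hardy_integrable_iff[OF assms(1)] by simp
  have "enn2real (hardy_integral p f t) \<le> enn2real (hardy_integral p (\<lambda>s. \<bar>f s\<bar>) t)"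
    "enn2real (hardy_integral p (\<lambda>s. - f s) t) \<le> enn2real (hardy_integral p (\<lambda>s. \<bar>f s\<bar>) t)"
    using fin by (auto intro!: enn2real_mono hardy_integral_mono)
  then have "\<bar>enn2real (hardy_integral p f t) - enn2real (hardy_integral p (\<lambda>s. - f s) t)\<bar> \<le>
      enn2real (hardy_integral p (\<lambda>s. \<bar>f s\<bar>) t)"
    using enn2real_nonneg[of "hardy_integral p f t"] enn2real_nonneg[of "hardy_integral p (\<lambda>s. - f s) t"] by linarith
  then have "\<bar>hardy p f t\<bar> \<le> t powr (- 1 / p) * enn2real (hardy_integral p (\<lambda>s. \<bar>f s\<bar>) t)"
    unfolding hardy_eq_hardy_integral[OF int] abs_mult
    by (intro mult_mono) auto
  then have "ennreal \<bar>hardy p f t\<bar> \<le> ennreal (t powr (- 1 / p) * enn2real (hardy_integral p (\<lambda>s. \<bar>f s\<bar>) t))"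
    by (rule ennreal_leI)
  then show ?thesis using fin by (simp add: hardy_nn_hardy_integral ennreal_mult')
qed

lemma hardy_eq_hardy_nn:
  assumes "hardy_defined p f" and "f \<in> borel_measurable leb_pos" and t: "t > 0"
    and nn: "\<And>s. 0 < s \<Longrightarrow> 0 \<le> f s"
  shows "hardy_nn p f t = ennreal (hardy p f t)"
proof -
  have int: "set_integrable lebesgue {0<..<t} (\<lambda>s. f s * s powr (1 / p - 1))"
    using assms by (simp add: hardy_defined_def)
  have "hardy_integral p f t = hardy_integral p (\<lambda>s. \<bar>f s\<bar>) t" by (rule hardy_integral_cong) (simp add: nn)
  then have fin: "hardy_integral p f t < \<infinity>"
    using hardy_integrable_iff[OF assms(2)] int by simp
  have "hardy_integral p (\<lambda>s. - f s) t = hardy_integral p (\<lambda>s. 0) t"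
    unfolding hardy_integral_def using nn
    by (intro nn_integral_cong) (auto simp: space_restrict_space ennreal_neg)
  also have "\<dots> = 0" by (simp add: hardy_integral_def)
  finally have h: "hardy p f t = t powr (- 1 / p) * enn2real (hardy_integral p f t)"
    by (simp add: hardy_eq_hardy_integral[OF int])
  show ?thesis
    using fin by (simp add: h hardy_nn_hardy_integral ennreal_mult')
qed

lemma hardy_diff:
  assumes "hardy_defined p f" "hardy_defined p g" and "t > 0"
  shows "hardy p f t - hardy p g t = hardy p (\<lambda>s. f s - g s) t"
  using assms unfolding hardy_defined_def hardy_def right_diff_distrib[symmetric]
  by (subst set_integral_diff(2)[symmetric]) (auto simp: left_diff_distrib)

lemma hardy_defined_diff:
  assumes "hardy_defined p f" "hardy_defined p g"
  shows "hardy_defined p (\<lambda>s. f s - g s)"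
  using assms unfolding hardy_defined_def left_diff_distrib by (auto intro!: set_integral_diff(1))

lemma modular_infinite:
  assumes "a > 0" "a < b" and "\<And>t. t \<in> {a<..<b} \<Longrightarrow> u t = \<infinity>"
  shows "modular \<Phi> \<gamma> u = \<infinity>"
proof -
  have s: "{a<..<b} \<in> sets leb_pos" using assms by (intro borel_set_leb_pos) auto
  have "emeasure leb_pos {a<..<b} = ennreal (b - a)"
    using assms by (subst emeasure_restrict_space) auto
  then have "\<infinity> = (\<integral>\<^sup>+t. \<infinity> * indicator {a<..<b} t \<partial>leb_pos)"
    using assms s by (subst nn_integral_cmult_indicator) (auto simp: ennreal_top_mult)
  also have "\<dots> \<le> modular \<Phi> \<gamma> u"
    unfolding modular_leb_pos using assms
    by (intro nn_integral_mono) (auto split: split_indicator simp: extend_top_def ennreal_top_mult)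
  finally show ?thesis by (simp add: top_unique)
qed

text \<open>An infinite value of \<open>P\<^sub>p |f|\<close> at one point would persist to the right of it up to a
  positive factor, and make the modular infinite; therefore the integrals that define \<open>P\<^sub>p f\<close>
  converge. By linearity, continuity is an estimate of \<open>P\<^sub>p h\<close> with \<open>h = |f - g|\<close>, and the constant
  \<open>B\<close> of the modular inequality is removed by shrinking the argument by \<open>B\<close> to the power \<open>- 1 / s\<close>.\<close>

lemma modular_inequality_imp_continuous:
  assumes \<Phi>1: "growth_function \<Phi>1" and s: "0 < s" and conv: "s_convex s \<Phi>1"
    and M: "modular_inequality p \<gamma> \<Phi>1 \<Phi>2"
  shows "hardy_maps_continuously s p \<gamma> \<Phi>1 \<Phi>2"
proof -
  note mono1 = growth_function_mono(1)[OF \<Phi>1]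
  from M obtain K where K: "K > 0" and le: "\<And>f. f \<in> borel_measurable leb_pos \<Longrightarrow> \<forall>t>0. 0 \<le> f t \<Longrightarrow>
      modular \<Phi>1 \<gamma> (hardy_nn p f) \<le> ennreal K * modular \<Phi>2 \<gamma> (\<lambda>s. ennreal (K * f s))"
    unfolding modular_inequality_def measurable_Rplus_iff by blast
  have maps: "hardy_defined p f \<and> hardy p f \<in> orlicz_class \<Phi>1 \<gamma>" if f: "f \<in> orlicz_class \<Phi>2 \<gamma>" for f
  proof -
    from f obtain k where f_meas[measurable]: "f \<in> borel_measurable leb_pos" and k: "k > 0"
      and fin: "modular \<Phi>2 \<gamma> (\<lambda>t. ennreal (k * \<bar>f t\<bar>)) < \<infinity>"
      by (auto simp: orlicz_class_iff)
    have scale: "hardy_nn p (\<lambda>s. k / K * \<bar>f s\<bar>) = (\<lambda>t. ennreal (k / K) * hardy_nn p (\<lambda>s. \<bar>f s\<bar>) t)"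
      using k K by (intro ext hardy_nn_cmult) auto
    have "modular \<Phi>1 \<gamma> (hardy_nn p (\<lambda>s. k / K * \<bar>f s\<bar>)) \<le>
        ennreal K * modular \<Phi>2 \<gamma> (\<lambda>s. ennreal (K * (k / K * \<bar>f s\<bar>)))"
      using k K by (intro le) auto
    also have "\<dots> < \<infinity>" using fin K by (simp add: ennreal_mult_less_top)
    finally have fin1: "modular \<Phi>1 \<gamma> (\<lambda>t. ennreal (k / K) * hardy_nn p (\<lambda>s. \<bar>f s\<bar>) t) < \<infinity>"
      by (simp only: scale)
    have "hardy_integral p (\<lambda>s. \<bar>f s\<bar>) t < \<infinity>" if t: "t > 0" for t
    proof (rule ccontr)
      assume "\<not> ?thesis"
      then have inf: "hardy_integral p (\<lambda>s. \<bar>f s\<bar>) t = \<infinity>" by (simp add: less_top[symmetric])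
      have "modular \<Phi>1 \<gamma> (\<lambda>t. ennreal (k / K) * hardy_nn p (\<lambda>s. \<bar>f s\<bar>) t) = \<infinity>"
      proof (rule modular_infinite[of t "t + 1"])
        fix r assume r: "r \<in> {t<..<t+1}"
        then have "hardy_integral p (\<lambda>s. \<bar>f s\<bar>) r = \<infinity>"
          using inf hardy_integral_mono_upper[of t r p "\<lambda>s. \<bar>f s\<bar>"] by (simp add: top_unique)
        then show "ennreal (k / K) * hardy_nn p (\<lambda>s. \<bar>f s\<bar>) r = \<infinity>"
          using k K r t by (simp add: hardy_nn_hardy_integral ennreal_mult_top)
      qed (use t in auto)
      then show False using fin1 by simp
    qed
    then have def: "hardy_defined p f"
      by (auto simp: hardy_defined_def hardy_integrable_iff)
    have "modular \<Phi>1 \<gamma> (\<lambda>t. ennreal (k / K * \<bar>hardy p f t\<bar>)) \<le>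
        modular \<Phi>1 \<gamma> (\<lambda>t. ennreal (k / K) * hardy_nn p (\<lambda>s. \<bar>f s\<bar>) t)"
    proof (rule modular_mono[OF mono1])
      fix t :: real assume "t > 0"
      then have "ennreal (k / K) * ennreal \<bar>hardy p f t\<bar> \<le> ennreal (k / K) * hardy_nn p (\<lambda>s. \<bar>f s\<bar>) t"
        by (intro mult_left_mono abs_hardy_le_hardy_nn def) auto
      then show "ennreal (k / K * \<bar>hardy p f t\<bar>) \<le> ennreal (k / K) * hardy_nn p (\<lambda>s. \<bar>f s\<bar>) t"
        by (simp only: ennreal_mult'' abs_ge_zero)
    qed
    also have "\<dots> < \<infinity>" by (rule fin1)
    finally show ?thesis using def k K
      by (auto simp: orlicz_class_iff hardy_measurable intro!: exI[of _ "k / K"])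
  qed
  have cont: "\<exists>\<delta>>0. \<forall>g\<in>orlicz_class \<Phi>2 \<gamma>. gauge_s s \<Phi>2 \<gamma> (\<lambda>t. f t - g t) < ennreal \<delta> \<longrightarrow>
      gauge_s s \<Phi>1 \<gamma> (\<lambda>t. hardy p f t - hardy p g t) < ennreal \<epsilon>"
    if f: "f \<in> orlicz_class \<Phi>2 \<gamma>" and \<epsilon>: "\<epsilon> > 0" for f and \<epsilon> :: real
  proof -
    define B where "B = max 1 K"
    have B: "B \<ge> 1" "B \<ge> K" by (auto simp: B_def)
    \<comment> \<open>One factor \<open>B\<^sup>s\<close> undoes the constant inside \<open>\<Phi>2\<close>, one factor \<open>B\<close> the constant in front.\<close>
    define \<delta> where "\<delta> = \<epsilon> / B powr (s + 1)"
    have \<delta>: "\<delta> > 0" using \<epsilon> B by (simp add: \<delta>_def)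
    show ?thesis
    proof (intro exI[of _ \<delta>] conjI \<delta> ballI impI)
      fix g assume g: "g \<in> orlicz_class \<Phi>2 \<gamma>"
        and close: "gauge_s s \<Phi>2 \<gamma> (\<lambda>t. f t - g t) < ennreal \<delta>"
      define h where "h = (\<lambda>t. \<bar>f t - g t\<bar>)"
      have [measurable]: "f \<in> borel_measurable leb_pos" "g \<in> borel_measurable leb_pos"
        using f g by (auto simp: orlicz_class_iff)
      have h[measurable]: "h \<in> borel_measurable leb_pos" by (simp add: h_def)
      obtain l where l: "l > 0" "l < \<delta>" and adm: "modular \<Phi>2 \<gamma> (\<lambda>t. ennreal (h t / l powr (1 / s))) \<le> 1"
        using close unfolding gauge_s_modular Inf_less_iff by (auto simp: ennreal_less_iff h_def)
      define a where "a = B powr (- 1 / s)"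
      define q where "q = l powr (1 / s)"
      have q: "q > 0" using l by (simp add: q_def)
      have a: "0 < a" "a powr s = 1 / B"
        using B s powr_minus_divide[of B 1] by (auto simp: a_def powr_powr simp del: powr_minus_divide)
      have a1: "a \<le> 1"
        using powr_mono[of "- 1 / s" 0 B] B s by (simp add: a_def)
      define l' where "l' = B powr (s + 1) * l"
      have l': "l' > 0" "l' < \<epsilon>" using l B by (auto simp: l'_def \<delta>_def field_simps)
      have l'_root: "l' powr (1 / s) = B * q / a"
      proof -
        have "l' powr (1 / s) = B powr ((s + 1) * (1 / s)) * q"
          using l B by (simp add: l'_def q_def powr_mult powr_powr)
        also have "(s + 1) * (1 / s) = 1 + 1 / s" using s by (simp add: field_simps)
        also have "B powr (1 + 1 / s) = B / a"
          using B by (simp add: a_def powr_add powr_minus_divide)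
        finally show ?thesis by simp
      qed
      have "modular \<Phi>1 \<gamma> (\<lambda>t. ennreal (\<bar>hardy p f t - hardy p g t\<bar> / l' powr (1 / s))) \<le>
          modular \<Phi>1 \<gamma> (\<lambda>t. ennreal a * hardy_nn p (\<lambda>s. 1 / (K * q) * h s) t)"
      proof (rule modular_mono[OF mono1])
        fix t :: real assume t: "t > 0"
        have "ennreal \<bar>hardy p f t - hardy p g t\<bar> \<le> hardy_nn p h t"
          using maps[OF f] maps[OF g] t unfolding h_def
          by (subst hardy_diff) (auto intro!: abs_hardy_le_hardy_nn hardy_defined_diff)
        then have "ennreal (a / (B * q)) * ennreal \<bar>hardy p f t - hardy p g t\<bar> \<le>
            ennreal (a * (1 / (K * q))) * hardy_nn p h t"
          using a q K B by (intro mult_mono ennreal_leI) (auto simp: field_simps)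
        moreover have "\<bar>hardy p f t - hardy p g t\<bar> / l' powr (1 / s) =
            a / (B * q) * \<bar>hardy p f t - hardy p g t\<bar>"
          by (simp add: l'_root)
        moreover have "ennreal (a * (1 / (K * q))) * hardy_nn p h t =
            ennreal a * hardy_nn p (\<lambda>s. 1 / (K * q) * h s) t"
          using a q K by (subst hardy_nn_cmult[OF h]) (simp, simp only: ennreal_mult' mult.assoc)
        ultimately show "ennreal (\<bar>hardy p f t - hardy p g t\<bar> / l' powr (1 / s)) \<le>
            ennreal a * hardy_nn p (\<lambda>s. 1 / (K * q) * h s) t"
          by (simp only: ennreal_mult'' abs_ge_zero)
      qed
      also have "\<dots> \<le> ennreal (a powr s) * modular \<Phi>1 \<gamma> (hardy_nn p (\<lambda>s. 1 / (K * q) * h s))"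
        by (rule modular_s_convex_scale[OF \<Phi>1 conv s]) (use a a1 in auto)
      also have "\<dots> \<le> ennreal (a powr s) *
          (ennreal K * modular \<Phi>2 \<gamma> (\<lambda>s. ennreal (K * (1 / (K * q) * h s))))"
        using K q by (intro mult_left_mono le) (auto simp: h_def)
      also have "\<dots> \<le> ennreal (1 / B) * (ennreal B * 1)"
        using adm K B unfolding a
        by (intro mult_left_mono mult_mono ennreal_leI) (auto simp: q_def)
      also have "\<dots> = 1" using B by (simp add: ennreal_mult'[symmetric])
      finally have "gauge_s s \<Phi>1 \<gamma> (\<lambda>t. hardy p f t - hardy p g t) \<le> ennreal l'"
        unfolding gauge_s_modular using l' by (intro Inf_lower) auto
      also have "\<dots> < ennreal \<epsilon>" using l' by (simp add: ennreal_less_iff)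
      finally show "gauge_s s \<Phi>1 \<gamma> (\<lambda>t. hardy p f t - hardy p g t) < ennreal \<epsilon>" .
    qed
  qed
  show ?thesis unfolding hardy_maps_continuously_def using maps cont by blast
qed

text \<open>Continuity at \<open>0\<close> sends a small multiple \<open>c f\<close> of each \<open>f\<close> in the modular unit
  ball of \<open>\<Phi>2\<close> into the modular unit ball of \<open>\<Phi>1\<close>, which is the hypothesis of
  \<open>modular_inequality_of_unit_ball\<close>.\<close>

lemma continuous_imp_modular_inequality:
  assumes "\<gamma> \<noteq> -1" and \<Phi>1: "growth_function \<Phi>1" and \<Phi>2: "growth_function \<Phi>2"
    and s: "0 < s" and I: "hardy_maps_continuously s p \<gamma> \<Phi>1 \<Phi>2"
  shows "modular_inequality p \<gamma> \<Phi>1 \<Phi>2"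
proof -
  note mono1 = growth_function_mono(1)[OF \<Phi>1] and mono2 = growth_function_mono(1)[OF \<Phi>2]
  have def: "hardy_defined p f" if "f \<in> orlicz_class \<Phi>2 \<gamma>" for f
    using I that by (auto simp: hardy_maps_continuously_def)
  have zero: "(\<lambda>t. 0) \<in> orlicz_class \<Phi>2 \<gamma>"
    using growth_function_mono(2)[OF \<Phi>2]
    by (auto simp: orlicz_class_iff modular_leb_pos extend_top_def intro!: exI[of _ 1])
  from I[unfolded hardy_maps_continuously_def, THEN conjunct2, THEN bspec, OF zero,
      THEN spec[of _ 1], THEN mp, OF zero_less_one]
  obtain \<delta> where \<delta>: "\<delta> > 0"
    and cont: "\<And>g. g \<in> orlicz_class \<Phi>2 \<gamma> \<Longrightarrow> gauge_s s \<Phi>2 \<gamma> (\<lambda>t. 0 - g t) < ennreal \<delta> \<Longrightarrow>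
      gauge_s s \<Phi>1 \<gamma> (\<lambda>t. hardy p (\<lambda>t. 0) t - hardy p g t) < ennreal 1"
    by blast
  define c where "c = (\<delta> / 2) powr (1 / s)"
  have c: "c > 0" using \<delta> by (simp add: c_def)
  show ?thesis
  proof (rule modular_inequality_of_unit_ball[OF assms(1) mono1 mono2 c zero_less_one])
    fix f :: "real \<Rightarrow> real"
    assume f[measurable]: "f \<in> borel_measurable leb_pos" and nn: "\<forall>t>0. 0 \<le> f t"
      and ball: "modular \<Phi>2 \<gamma> (\<lambda>t. ennreal (f t)) \<le> 1"
    define g where "g = (\<lambda>t. c * f t)"
    have g[measurable]: "g \<in> borel_measurable leb_pos" by (simp add: g_def)
    have g_nn: "\<And>t. 0 < t \<Longrightarrow> 0 \<le> g t" using c nn by (simp add: g_def)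
    have "modular \<Phi>2 \<gamma> (\<lambda>t. ennreal (1 / c * \<bar>g t\<bar>)) = modular \<Phi>2 \<gamma> (\<lambda>t. ennreal (f t))"
      using c nn by (intro modular_cong) (simp add: g_def)
    then have adm: "modular \<Phi>2 \<gamma> (\<lambda>t. ennreal (1 / c * \<bar>g t\<bar>)) \<le> 1" using ball by simp
    then have g_class: "g \<in> orlicz_class \<Phi>2 \<gamma>"
      using c by (auto simp: orlicz_class_iff intro!: exI[of _ "1 / c"] le_less_trans[OF adm[simplified]])
    have "gauge_s s \<Phi>2 \<gamma> (\<lambda>t. 0 - g t) \<le> ennreal (\<delta> / 2)"
      unfolding gauge_s_modular using \<delta> adm
      by (intro Inf_lower) (auto simp: c_def intro!: exI[of _ "\<delta> / 2"])
    also have "\<dots> < ennreal \<delta>" using \<delta> by (simp add: ennreal_less_iff)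
    finally have "gauge_s s \<Phi>1 \<gamma> (\<lambda>t. hardy p (\<lambda>t. 0) t - hardy p g t) < ennreal 1"
      by (rule cont[OF g_class])
    moreover have "hardy p (\<lambda>t. 0) t = 0" for t by (simp add: hardy_def)
    ultimately obtain l where l: "l > 0" "l < 1"
      and l_adm: "modular \<Phi>1 \<gamma> (\<lambda>t. ennreal (\<bar>hardy p g t\<bar> / l powr (1 / s))) \<le> 1"
      unfolding gauge_s_modular Inf_less_iff by (auto simp: ennreal_less_iff simp del: ennreal_1)
    have root: "0 < l powr (1 / s)" "l powr (1 / s) \<le> 1" using l s by (auto intro!: powr_le1)
    have "modular \<Phi>1 \<gamma> (\<lambda>t. ennreal c * hardy_nn p f t) \<le>
        modular \<Phi>1 \<gamma> (\<lambda>t. ennreal (\<bar>hardy p g t\<bar> / l powr (1 / s)))"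
    proof (rule modular_mono[OF mono1])
      fix t :: real assume t: "t > 0"
      have "ennreal c * hardy_nn p f t = hardy_nn p g t"
        unfolding g_def using c by (subst hardy_nn_cmult) auto
      also have "\<dots> = ennreal (hardy p g t)"
        by (rule hardy_eq_hardy_nn[OF def[OF g_class] g t g_nn])
      also have "\<dots> \<le> ennreal (\<bar>hardy p g t\<bar> / l powr (1 / s))"
      proof (rule ennreal_leI)
        have "hardy p g t * l powr (1 / s) \<le> \<bar>hardy p g t\<bar> * 1"
          using root by (intro mult_mono) auto
        then show "hardy p g t \<le> \<bar>hardy p g t\<bar> / l powr (1 / s)"
          using root by (simp add: le_divide_eq)
      qed
      finally show "ennreal c * hardy_nn p f t \<le> ennreal (\<bar>hardy p g t\<bar> / l powr (1 / s))" .
    qed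
    with l_adm show "modular \<Phi>1 \<gamma> (\<lambda>t. ennreal c * hardy_nn p f t) \<le> ennreal 1"
      by simp
  qed
qed

section \<open>Young functions, generalized inverses and complementary functions\<close>

lemma measurable_mono_on_compose:
  fixes \<Phi> :: "real \<Rightarrow> real"
  assumes "mono_on A \<Phi>" and "g \<in> borel_measurable M" and "\<And>x. x \<in> space M \<Longrightarrow> g x \<in> A"
  shows "(\<lambda>x. \<Phi> (g x)) \<in> borel_measurable M"
proof -
  have "g \<in> measurable M (restrict_space borel A)"
    using assms(2,3) by (intro measurable_restrict_space2) auto
  from measurable_compose[OF this borel_measurable_mono_on_fnc[OF assms(1)]] show ?thesis .
qed

lemma set_integral_interval_const:
  fixes a b c :: real
  assumes "a \<le> b"
  shows "(LINT s:{a<..<b}|lebesgue. c) = (b - a) * c"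
  using assms by (simp add: set_lebesgue_integral_def)

text \<open>The following facts are applied both to the density of a Young function and, for the
  complementary function, to its generalized inverse.\<close>

context
  fixes \<phi> :: "real \<Rightarrow> real"
  assumes mono: "mono_on {0<..} \<phi>" and nonneg: "\<And>r. 0 < r \<Longrightarrow> 0 \<le> \<phi> r"
begin

lemma density_integrable:
  assumes "0 \<le> a" "a \<le> b"
  shows "set_integrable lebesgue {a<..<b} \<phi>"
proof (cases "a < b")
  case True
  have "(\<lambda>s. \<phi> s) \<in> borel_measurable leb_pos"
    by (rule measurable_mono_on_compose[OF mono]) (auto simp: space_restrict_space)
  then have "(\<lambda>s. indicator {0<..} s *\<^sub>R \<phi> s) \<in> borel_measurable lebesgue"
    by (subst (asm) borel_measurable_restrict_space_iff) auto
  then have "(\<lambda>s. indicator {a<..<b} s * (indicator {0<..} s *\<^sub>R \<phi> s)) \<in> borel_measurable lebesgue"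
    by (intro borel_measurable_times borel_measurable_indicator) auto
  also have "(\<lambda>s. indicator {a<..<b} s * (indicator {0<..} s *\<^sub>R \<phi> s)) = (\<lambda>s. indicator {a<..<b} s *\<^sub>R \<phi> s)"
    using assms by (auto simp: fun_eq_iff split: split_indicator)
  finally have m: "(\<lambda>s. indicator {a<..<b} s *\<^sub>R \<phi> s) \<in> borel_measurable lebesgue" .
  have "set_integrable lebesgue {a<..<b} (\<lambda>s. \<phi> b)"
    unfolding set_integrable_def using assms
    by (intro integrable_scaleR_left integrable_real_indicator) auto
  then show ?thesis unfolding set_integrable_def
  proof (rule Bochner_Integration.integrable_bound[OF _ m])
    show "AE s in lebesgue. norm (indicator {a<..<b} s *\<^sub>R \<phi> s) \<le> norm (indicator {a<..<b} s *\<^sub>R \<phi> b)"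
      using assms True nonneg
      by (intro always_eventually) (auto split: split_indicator intro!: mono_onD[OF mono] order_trans[OF _ abs_ge_self])
  qed
qed (simp add: set_integrable_def)

lemma primitive_0: "primitive \<phi> 0 = 0"
  by (simp add: primitive_def set_lebesgue_integral_def)

lemma primitive_split:
  assumes "0 \<le> a" "a \<le> b"
  shows "primitive \<phi> b = primitive \<phi> a + (LINT s:{a<..<b}|lebesgue. \<phi> s)"
proof -
  have "(LINT s:{0<..<b}|lebesgue. \<phi> s) = (LINT s:{0<..<a} \<union> {a<..<b}|lebesgue. \<phi> s)"
    unfolding set_lebesgue_integral_def
  proof (rule integral_cong_AE)
    have "AE s in lebesgue. s \<noteq> a" by (intro AE_I'[of "{a}"]) auto
    then show "AE s in lebesgue. indicator {0<..<b} s *\<^sub>R \<phi> s =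
        indicator ({0<..<a} \<union> {a<..<b}) s *\<^sub>R \<phi> s"
      by eventually_elim (use assms in \<open>auto split: split_indicator\<close>)
    show "(\<lambda>s. indicator {0<..<b} s *\<^sub>R \<phi> s) \<in> borel_measurable lebesgue"
      using density_integrable[of 0 b] assms by (auto simp: set_integrable_def)
    have "set_integrable lebesgue ({0<..<a} \<union> {a<..<b}) \<phi>"
      using assms by (intro set_integrable_Un density_integrable) auto
    then show "(\<lambda>s. indicator ({0<..<a} \<union> {a<..<b}) s *\<^sub>R \<phi> s) \<in> borel_measurable lebesgue"
      by (auto simp: set_integrable_def)
  qed
  also have "\<dots> = (LINT s:{0<..<a}|lebesgue. \<phi> s) + (LINT s:{a<..<b}|lebesgue. \<phi> s)"
    using assms by (intro set_integral_Un density_integrable) auto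
  finally show ?thesis by (simp add: primitive_def)
qed

lemma primitive_upper:
  assumes "0 \<le> a" "a \<le> b" and "\<And>r. a < r \<Longrightarrow> r < b \<Longrightarrow> \<phi> r \<le> c"
  shows "primitive \<phi> b \<le> primitive \<phi> a + (b - a) * c"
proof -
  have "(LINT s:{a<..<b}|lebesgue. \<phi> s) \<le> (LINT s:{a<..<b}|lebesgue. c)"
    using assms by (intro set_integral_mono density_integrable)
      (auto simp: set_integrable_def)
  then show ?thesis using primitive_split[OF assms(1,2)] assms by (simp add: set_integral_interval_const)
qed

lemma primitive_lower:
  assumes "0 \<le> a" "a \<le> b" and "\<And>r. a < r \<Longrightarrow> r < b \<Longrightarrow> c \<le> \<phi> r"
  shows "primitive \<phi> a + (b - a) * c \<le> primitive \<phi> b"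
proof -
  have "(LINT s:{a<..<b}|lebesgue. c) \<le> (LINT s:{a<..<b}|lebesgue. \<phi> s)"
    using assms by (intro set_integral_mono density_integrable)
      (auto simp: set_integrable_def)
  then show ?thesis using primitive_split[OF assms(1,2)] assms by (simp add: set_integral_interval_const)
qed

lemma primitive_mono: "mono_on {0..} (primitive \<phi>)"
proof (rule mono_onI)
  fix a b :: real assume "a \<in> {0..}" "b \<in> {0..}" "a \<le> b"
  then show "primitive \<phi> a \<le> primitive \<phi> b"
    using primitive_lower[of a b 0] nonneg by auto
qed

lemma primitive_nonneg: "0 \<le> t \<Longrightarrow> 0 \<le> primitive \<phi> t"
  using mono_onD[OF primitive_mono, of 0 t] primitive_0 by simp

lemma primitive_le_mult:
  assumes "0 < b" shows "primitive \<phi> b \<le> b * \<phi> b"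
proof -
  have "\<phi> r \<le> \<phi> b" if "0 < r" "r < b" for r using that by (intro mono_onD[OF mono]) auto
  then show ?thesis using primitive_upper[of 0 b "\<phi> b"] assms primitive_0 by simp
qed

lemma mult_le_primitive_double:
  assumes "0 < a" shows "a * \<phi> a \<le> primitive \<phi> (2 * a)"
proof -
  have "\<phi> a \<le> \<phi> r" if "a < r" for r using that assms by (intro mono_onD[OF mono]) auto
  then show ?thesis using primitive_lower[of a "2 * a" "\<phi> a"] assms primitive_nonneg[of a] by simp
qed

text \<open>Convexity together with the value \<open>0\<close> at \<open>0\<close>, obtained from the monotonicity of the density:
  the mean of \<open>\<phi>\<close> over \<open>(0, c x)\<close> is at most \<open>\<phi>(c x)\<close>, and the mean over \<open>(c x, x)\<close> is at least
  this value.\<close>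

lemma primitive_scale:
  assumes "0 \<le> c" "c \<le> 1" "0 \<le> x"
  shows "primitive \<phi> (c * x) \<le> c * primitive \<phi> x"
proof (cases "c * x = 0")
  case True
  then show ?thesis using primitive_0 primitive_nonneg[of x] assms by auto
next
  case False
  then have pos: "0 < c * x" and le: "c * x \<le> x" using assms by (auto simp: mult_left_le_one_le zero_less_mult_iff)
  have "(1 - c) * primitive \<phi> (c * x) \<le> (1 - c) * (c * x * \<phi> (c * x))"
    using assms primitive_le_mult[OF pos] by (intro mult_left_mono) auto
  moreover have "primitive \<phi> (c * x) + (x - c * x) * \<phi> (c * x) \<le> primitive \<phi> x"
    using pos le by (intro primitive_lower) (auto intro!: mono_onD[OF mono])
  then have "c * (primitive \<phi> (c * x) + (x - c * x) * \<phi> (c * x)) \<le> c * primitive \<phi> x"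
    using assms by (intro mult_left_mono) auto
  ultimately show ?thesis by (simp add: algebra_simps)
qed

end

context
  fixes \<phi> :: "real \<Rightarrow> real"
  assumes young: "young_density \<phi>"
begin

lemma young_density_mono: "mono_on {0<..} \<phi>" and young_density_nonneg: "0 < r \<Longrightarrow> 0 \<le> \<phi> r"
  using young by (auto simp: young_density_def)

lemma generalized_inverse_bdd: "bdd_above {r. 0 < r \<and> \<phi> r \<le> b}"
proof -
  have "eventually (\<lambda>r. b < \<phi> r) at_top"
    using young by (auto simp: young_density_def filterlim_at_top_dense)
  then obtain R where R: "\<And>r. R \<le> r \<Longrightarrow> b < \<phi> r" by (auto simp: eventually_at_top_linorder)
  show ?thesis
  proof (rule bdd_aboveI)
    fix r assume "r \<in> {r. 0 < r \<and> \<phi> r \<le> b}"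
    then show "r \<le> R" using R[of r] by (cases "r \<le> R") auto
  qed
qed

text \<open>This is where \<open>\<phi>(0+) = 0\<close> enters: the supremum that defines the inverse is over a nonempty
  set at every positive argument, although not necessarily at \<open>0\<close>.\<close>

lemma generalized_inverse_nonempty:
  assumes "0 < b" obtains r where "0 < r" "\<phi> r \<le> b"
proof -
  have "eventually (\<lambda>r. \<phi> r < b) (at_right 0)"
    using young assms by (auto simp: young_density_def order_tendsto_iff)
  then obtain d where "d > 0" "\<And>r. 0 < r \<Longrightarrow> r < d \<Longrightarrow> \<phi> r < b"
    by (auto simp: eventually_at_right_field)
  then show thesis using that[of "d / 2"] by (simp add: less_imp_le)
qed

lemma le_generalized_inverse: "0 < r \<Longrightarrow> \<phi> r \<le> b \<Longrightarrow> r \<le> generalized_inverse \<phi> b"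
  unfolding generalized_inverse_def by (rule cSup_upper) (auto intro: generalized_inverse_bdd)

lemma generalized_inverse_pos:
  assumes "0 < b" shows "0 < generalized_inverse \<phi> b"
proof -
  obtain r where "0 < r" "\<phi> r \<le> b" using generalized_inverse_nonempty[OF assms] .
  then show ?thesis using le_generalized_inverse[of r b] by linarith
qed

lemma less_generalized_inverse:
  assumes "0 < b" "0 < r" "r < generalized_inverse \<phi> b" shows "\<phi> r \<le> b"
proof -
  obtain x where "0 < x" "\<phi> x \<le> b" using generalized_inverse_nonempty[OF assms(1)] .
  then have "{r. 0 < r \<and> \<phi> r \<le> b} \<noteq> {}" by auto
  from less_cSupE[OF assms(3)[unfolded generalized_inverse_def] this]
  obtain y where y: "r < y" "0 < y" "\<phi> y \<le> b" by auto
  then show ?thesis using mono_onD[OF young_density_mono, of r y] assms(2) by auto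
qed

lemma generalized_inverse_mono: "mono_on {0<..} (generalized_inverse \<phi>)"
proof (rule mono_onI)
  fix a b :: real assume ab: "a \<in> {0<..}" "b \<in> {0<..}" "a \<le> b"
  obtain x where "0 < x" "\<phi> x \<le> a" using generalized_inverse_nonempty ab(1) by auto
  then show "generalized_inverse \<phi> a \<le> generalized_inverse \<phi> b"
    unfolding generalized_inverse_def using ab generalized_inverse_bdd
    by (intro cSup_subset_mono) auto
qed

lemma generalized_inverse_nonneg: "0 < b \<Longrightarrow> 0 \<le> generalized_inverse \<phi> b"
  using generalized_inverse_pos by force

text \<open>To the left of \<open>\<psi>(b)\<close> the density is at most \<open>b\<close>. This is the equality case
  \<open>\<Phi>(\<psi>(b)) + \<Psi>(b) = b \<psi>(b)\<close> of Young's inequality without the nonnegative term \<open>\<Psi>(b)\<close>.\<close>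

lemma primitive_at_inverse:
  assumes "0 < b"
  shows "primitive \<phi> (generalized_inverse \<phi> b) \<le> b * generalized_inverse \<phi> b"
proof -
  have "primitive \<phi> (generalized_inverse \<phi> b) \<le>
      primitive \<phi> 0 + (generalized_inverse \<phi> b - 0) * b"
    using generalized_inverse_nonneg[OF assms] less_generalized_inverse[OF assms]
    by (intro primitive_upper[OF young_density_mono young_density_nonneg]) auto
  then show ?thesis
    by (simp add: primitive_0[OF young_density_mono young_density_nonneg] mult.commute)
qed

text \<open>Beyond \<open>\<psi>(b)\<close> the density exceeds \<open>b\<close>. This replaces Young's inequality in the weak type
  estimate.\<close>

lemma mult_le_primitive_beyond_inverse:
  assumes "0 < a" "generalized_inverse \<phi> b < a"
  shows "a * b \<le> primitive \<phi> (2 * a)"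
proof -
  have "b < \<phi> a" using le_generalized_inverse[of a b] assms by force
  then have "a * b \<le> a * \<phi> a" using assms by simp
  then show ?thesis
    using mult_le_primitive_double[OF young_density_mono young_density_nonneg assms(1)] by linarith
qed

lemma complementary_upper: "0 < b \<Longrightarrow> complementary \<phi> b \<le> b * generalized_inverse \<phi> b"
  unfolding complementary_def
  by (rule primitive_le_mult[OF generalized_inverse_mono generalized_inverse_nonneg])

lemma complementary_lower: "0 < b \<Longrightarrow> b * generalized_inverse \<phi> b \<le> complementary \<phi> (2 * b)"
  unfolding complementary_def
  by (rule mult_le_primitive_double[OF generalized_inverse_mono generalized_inverse_nonneg])

end

section \<open>From weak type to the modular inequality\<close>

text \<open>The tail integral \<open>\<alpha>(t)\<close> with a level \<open>l\<close> inserted; \<open>l = 1\<close> gives \<open>\<alpha>(t)\<close>. If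
  the integral of \<open>f(s) s\<^bsup>1/p-1\<^esup>\<close> over \<open>(0,t)\<close> is at least \<open>l\<close>, then
  this tail is a lower bound for the modular of \<open>P\<^sub>p f\<close>.\<close>

definition scaled_tail :: "real \<Rightarrow> real \<Rightarrow> (real \<Rightarrow> real) \<Rightarrow> real \<Rightarrow> real \<Rightarrow> ennreal" where
  "scaled_tail p \<gamma> \<Phi> l t =
    (\<integral>\<^sup>+s\<in>{t<..}. ennreal (\<Phi> (l * s powr (- 1 / p)) * s powr \<gamma>) \<partial>leb_pos)"

text \<open>Unlike in the modular inequality, the left side only involves one value of the increasing
  function \<open>t \<mapsto> t\<^bsup>1/p\<^esup> (P\<^sub>p f)(t)\<close>, and the right side only the part of \<open>f\<close> before \<open>t\<close>.
  The latter makes it possible to apply the estimate to pieces of \<open>f\<close> and to add up.\<close>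

definition weak_type :: "real \<Rightarrow> real \<Rightarrow> (real \<Rightarrow> real) \<Rightarrow> (real \<Rightarrow> real) \<Rightarrow> real \<Rightarrow> bool" where
  "weak_type p \<gamma> \<Phi>1 \<Phi>2 C \<longleftrightarrow>
    (\<forall>f t l. f \<in> borel_measurable leb_pos \<longrightarrow> (\<forall>s>0. 0 \<le> f s) \<longrightarrow> 0 < t \<longrightarrow> 0 < l \<longrightarrow>
      ennreal l \<le> hardy_integral p f t \<longrightarrow>
      scaled_tail p \<gamma> \<Phi>1 l t \<le>
      (\<integral>\<^sup>+s\<in>{0<..<t}. ennreal (\<Phi>2 (C * f s) * s powr \<gamma>) \<partial>leb_pos))"

text \<open>The last point at which a level is attained: taking the last one makes the superlevel set
  exactly a half line, so that the dyadic pieces below are intervals.\<close>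

lemma level_point:
  fixes F :: "real \<Rightarrow> real"
  assumes cont: "continuous_on {0..} F" and mono: "mono_on {0..} F"
    and c: "F 0 < c" and b: "0 < b" "c < F b"
  obtains \<tau> where "0 < \<tau>" "F \<tau> = c" "\<And>s. 0 < s \<Longrightarrow> c < F s \<longleftrightarrow> \<tau> < s"
proof -
  define S where "S = {s \<in> {0..b}. F s \<le> c}"
  have "closed S"
    unfolding S_def using cont
    by (intro continuous_closed_preimage[of "{0..b}" F "{..c}", unfolded vimage_def Int_def, simplified]
        continuous_on_subset[OF cont] | simp)+
  moreover have "0 \<in> S" "bdd_above S" using b c by (auto simp: S_def bdd_above_def)
  ultimately have sup: "Sup S \<in> S" by (intro closed_contains_Sup) auto
  define \<tau> where "\<tau> = Sup S"
  have \<tau>: "0 \<le> \<tau>" "\<tau> \<le> b" "F \<tau> \<le> c" using sup by (auto simp: S_def \<tau>_def)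
  have "\<tau> \<noteq> b" using \<tau> b by auto
  obtain x where x: "\<tau> \<le> x" "x \<le> b" "F x = c"
    using IVT'[of F \<tau> c b] \<tau> b continuous_on_subset[OF cont, of "{\<tau>..b}"] by auto
  have "x \<in> S" using x \<tau> by (auto simp: S_def)
  then have "x \<le> \<tau>" unfolding \<tau>_def using \<open>bdd_above S\<close> by (rule cSup_upper)
  then have F: "F \<tau> = c" using x by simp
  then have pos: "0 < \<tau>" using c \<tau> by (cases "\<tau> = 0") auto
  have "c < F s \<longleftrightarrow> \<tau> < s" if s: "0 < s" for s
  proof
    assume "c < F s"
    then show "\<tau> < s" using F mono_onD[OF mono, of s \<tau>] s by (cases "s \<le> \<tau>") auto
  next
    assume "\<tau> < s"
    show "c < F s"
    proof (rule ccontr)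
      assume n: "\<not> c < F s"
      then have "s \<le> b" using b mono_onD[OF mono, of b s] s by (cases "s \<le> b") auto
      then have "s \<in> S" using n s by (auto simp: S_def)
      then have "s \<le> \<tau>" unfolding \<tau>_def using \<open>bdd_above S\<close> by (rule cSup_upper)
      then show False using \<open>\<tau> < s\<close> by simp
    qed
  qed
  then show thesis using that[OF pos F] by blast
qed

lemma hardy_integral_continuous:
  assumes f[measurable]: "f \<in> borel_measurable leb_pos" and nn: "\<forall>s>0. 0 \<le> f s"
    and fin: "\<And>t. 0 < t \<Longrightarrow> hardy_integral p f t < \<infinity>"
  shows "continuous_on {0..} (\<lambda>t. enn2real (hardy_integral p f t))"
proof -
  define g where "g s = (if 0 < s then f s * s powr (1 / p - 1) else 0)" for s
  have g_nn: "0 \<le> g s" for s using nn by (simp add: g_def)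
  have "(\<lambda>s. f s * s powr (1 / p - 1)) \<in> borel_measurable leb_pos" by measurable
  then have "(\<lambda>s. indicator {0<..} s *\<^sub>R (f s * s powr (1 / p - 1))) \<in> borel_measurable lebesgue"
    by (subst (asm) borel_measurable_restrict_space_iff) auto
  also have "(\<lambda>s. indicator {0<..} s *\<^sub>R (f s * s powr (1 / p - 1))) = g"
    by (auto simp: g_def fun_eq_iff split: split_indicator)
  finally have g: "g \<in> borel_measurable lebesgue" .
  have eq: "(\<integral>\<^sup>+s\<in>{0..t}. ennreal (g s) \<partial>lebesgue) = hardy_integral p f t" for t
  proof -
    have "hardy_integral p f t = (\<integral>\<^sup>+s\<in>{0<..<t}. ennreal (f s * s powr (1 / p - 1)) \<partial>lebesgue)"
      unfolding hardy_integral_def by (rule set_nn_integral_leb_pos[symmetric]) auto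
    also have "\<dots> = (\<integral>\<^sup>+s\<in>{0..t}. ennreal (g s) \<partial>lebesgue)"
    proof (rule nn_integral_cong_AE)
      have "AE s in lebesgue. s \<noteq> t"
        by (intro AE_I'[of "{t}"]) auto
      then show "AE s in lebesgue. ennreal (f s * s powr (1 / p - 1)) * indicator {0<..<t} s =
          ennreal (g s) * indicator {0..t} s"
        by eventually_elim (auto simp: g_def split: split_indicator)
    qed
    finally show ?thesis by simp
  qed
  have int: "set_integrable lebesgue {0..t} g" for t
  proof -
    have "(\<lambda>s. indicator {0..t} s *\<^sub>R g s) \<in> borel_measurable lebesgue"
      using g by (intro borel_measurable_scaleR borel_measurable_indicator) auto
    moreover have "(\<integral>\<^sup>+s. ennreal (norm (indicator {0..t} s *\<^sub>R g s)) \<partial>lebesgue) = hardy_integral p f t"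
      unfolding eq[symmetric] using g_nn
      by (intro nn_integral_cong) (auto split: split_indicator)
    moreover have "hardy_integral p f t < \<infinity>"
      using fin[of t] by (cases "t > 0") (auto simp: hardy_integral_def)
    ultimately show ?thesis unfolding set_integrable_def integrable_iff_bounded by simp
  qed
  have val: "integral {0..t} g = enn2real (hardy_integral p f t)" for t
  proof -
    have "integral {0..t} g = (LINT s:{0..t}|lebesgue. g s)"
      using set_lebesgue_integral_eq_integral(2)[OF int] by simp
    also have "\<dots> = enn2real (\<integral>\<^sup>+s. ennreal (indicator {0..t} s *\<^sub>R g s) \<partial>lebesgue)"
      unfolding set_lebesgue_integral_def
      using int[of t] g_nn by (intro integral_eq_nn_integral)
        (auto simp: set_integrable_def dest: borel_measurable_integrable)
    also have "(\<integral>\<^sup>+s. ennreal (indicator {0..t} s *\<^sub>R g s) \<partial>lebesgue) = hardy_integral p f t"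
      unfolding eq[symmetric] by (intro nn_integral_cong) (auto split: split_indicator)
    finally show ?thesis .
  qed
  have loc: "continuous_on {0..b} (\<lambda>t. enn2real (hardy_integral p f t))" for b
    unfolding val[symmetric]
    by (intro indefinite_integral_continuous_1 set_lebesgue_integral_eq_integral(1) int)
  show ?thesis
  proof (rule continuous_on_eq_continuous_within[THEN iffD2], rule ballI)
    fix x :: real assume x: "x \<in> {0..}"
    have "continuous (at x within {0..x+1}) (\<lambda>t. enn2real (hardy_integral p f t))"
      using loc[of "x + 1"] x by (auto simp: continuous_on_eq_continuous_within)
    moreover have "at x within {0..x+1} = at x within {0..}"
      using x by (intro at_within_nhd[of _ "{..<x+1}"]) auto
    ultimately show "continuous (at x within {0..}) (\<lambda>t. enn2real (hardy_integral p f t))" by simp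
  qed
qed

lemma AE_leb_pos_neq: "AE s in leb_pos. s \<noteq> x"
proof -
  have "AE s in lebesgue. s \<noteq> x" by (intro AE_I'[of "{x}"]) auto
  then show ?thesis by (simp add: AE_restrict_space_iff eventually_mono)
qed

text \<open>The point \<open>\<sigma>\<close> itself is lost on the right side, which is harmless because it is a null set.\<close>

lemma hardy_integral_split:
  assumes f[measurable]: "f \<in> borel_measurable leb_pos" and \<sigma>: "0 \<le> \<sigma>" "\<sigma> \<le> \<tau>"
  shows "hardy_integral p f \<tau> = hardy_integral p f \<sigma> + hardy_integral p (\<lambda>s. f s * indicator {\<sigma><..} s) \<tau>"
proof -
  have "hardy_integral p f \<sigma> + hardy_integral p (\<lambda>s. f s * indicator {\<sigma><..} s) \<tau> =
     (\<integral>\<^sup>+s. ennreal (f s * s powr (1 / p - 1)) * indicator {0<..<\<sigma>} s +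
        ennreal (f s * indicator {\<sigma><..} s * s powr (1 / p - 1)) * indicator {0<..<\<tau>} s \<partial>leb_pos)"
    unfolding hardy_integral_def by (rule nn_integral_add[symmetric]) measurable
  also have "\<dots> = hardy_integral p f \<tau>"
    unfolding hardy_integral_def using \<sigma>
    by (intro nn_integral_cong_AE eventually_mono[OF AE_leb_pos_neq[of \<sigma>]])
      (auto split: split_indicator)
  finally show ?thesis by simp
qed

lemma powr_bounds:
  fixes a b x :: real
  assumes "0 < a" "a \<le> b"
  obtains m M where "0 < m" "0 < M" "\<And>s. s \<in> {a..b} \<Longrightarrow> m \<le> s powr x \<and> s powr x \<le> M"
proof
  fix s assume "s \<in> {a..b}"
  then have s: "a \<le> s" "s \<le> b" by auto
  have "a powr x \<le> s powr x \<and> s powr x \<le> b powr x" if "0 \<le> x"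
    using s assms that by (auto intro!: powr_mono2)
  moreover have "b powr x \<le> s powr x \<and> s powr x \<le> a powr x" if "\<not> 0 \<le> x"
    using s assms that by (auto intro!: powr_mono2')
  ultimately show "min (a powr x) (b powr x) \<le> s powr x \<and> s powr x \<le> max (a powr x) (b powr x)"
    by (cases "0 \<le> x") auto
qed (use assms in \<open>auto simp: less_max_iff_disj\<close>)

lemma emeasure_leb_pos_interval:
  "0 \<le> a \<Longrightarrow> a \<le> b \<Longrightarrow> emeasure leb_pos {a<..<b} = ennreal (b - a)"
  by (subst emeasure_restrict_space) auto

lemma scaled_tail_lower:
  assumes \<Phi>: "mono_on {0..} \<Phi>" "\<And>x. 0 \<le> x \<Longrightarrow> 0 \<le> \<Phi> x" and t: "t > 0"
  obtains m w where "0 < m" "0 < w"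
    "\<And>l. 0 < l \<Longrightarrow> ennreal (\<Phi> (l * m) * w) \<le> scaled_tail p \<gamma> \<Phi> l t"
proof -
  have t2: "t \<le> 2 * t" using t by simp
  obtain m where m: "m > 0" "\<And>s. s \<in> {t..2 * t} \<Longrightarrow> m \<le> s powr (- 1 / p)"
    using powr_bounds[OF t t2, of "- 1 / p"] by metis
  obtain w where w: "w > 0" "\<And>s. s \<in> {t..2 * t} \<Longrightarrow> w \<le> s powr \<gamma>"
    using powr_bounds[OF t t2, of \<gamma>] by metis
  have "ennreal (\<Phi> (l * m) * (w * t)) \<le> scaled_tail p \<gamma> \<Phi> l t" if l: "0 < l" for l
  proof -
    have s: "{t<..<2 * t} \<in> sets leb_pos" using t by (intro borel_set_leb_pos) auto
    have "ennreal (\<Phi> (l * m) * (w * t)) = (\<integral>\<^sup>+s. ennreal (\<Phi> (l * m) * w) * indicator {t<..<2 * t} s \<partial>leb_pos)"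
      using s \<Phi> w t l m by (subst nn_integral_cmult_indicator)
        (auto simp: emeasure_leb_pos_interval ennreal_mult'' mult.assoc[symmetric])
    also have "\<dots> \<le> scaled_tail p \<gamma> \<Phi> l t"
      unfolding scaled_tail_def
    proof (intro nn_integral_mono)
      fix s
      have "\<Phi> (l * m) * w \<le> \<Phi> (l * s powr (- 1 / p)) * s powr \<gamma>" if "s \<in> {t<..<2 * t}"
        using that w m l by (intro mult_mono \<Phi>(2) mono_onD[OF \<Phi>(1)] mult_left_mono) auto
      then show "ennreal (\<Phi> (l * m) * w) * indicator {t<..<2 * t} s \<le>
          ennreal (\<Phi> (l * s powr (- 1 / p)) * s powr \<gamma>) * indicator {t<..} s"
        by (auto split: split_indicator intro: ennreal_leI)
    qed
    finally show ?thesis .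
  qed
  then show thesis using that[of m "w * t"] m(1) w(1) t by simp
qed

text \<open>The tail grows without bound with the level, since \<open>\<Phi>\<close> is onto. This settles functions for
  which \<open>P\<^sub>p f\<close> is infinite somewhere: they satisfy the weak type estimate at all levels.\<close>

lemma scaled_tail_unbounded:
  assumes \<Phi>: "growth_function \<Phi>" and t: "t > 0"
    and le: "\<And>l. l > 0 \<Longrightarrow> scaled_tail p \<gamma> \<Phi> l t \<le> X"
  shows "X = \<infinity>"
proof (rule ccontr)
  assume "X \<noteq> \<infinity>"
  then obtain x where x: "X = ennreal x" "0 \<le> x" by (cases X rule: ennreal_cases) auto
  obtain m w where m: "0 < m" and w: "0 < w"
    and lower: "\<And>l. 0 < l \<Longrightarrow> ennreal (\<Phi> (l * m) * w) \<le> scaled_tail p \<gamma> \<Phi> l t"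
    using scaled_tail_lower[OF growth_function_mono(1,3)[OF \<Phi>] t] by metis
  have "(x + 1) / w \<in> \<Phi> ` {0<..}"
    using \<Phi> x w by (simp add: growth_function_def)
  then obtain y where y: "y > 0" "\<Phi> y = (x + 1) / w" by auto
  have "ennreal (\<Phi> (y / m * m) * w) \<le> ennreal x"
    using order_trans[OF lower le, of "y / m"] y m unfolding x(1) by simp
  then have "\<Phi> (y / m * m) * w \<le> x" using x by (simp only: ennreal_le_iff)
  then show False using y m w by simp
qed

text \<open>The half line is cut where \<open>F(t)\<close>, the integral of \<open>f(s) s\<^bsup>1/p-1\<^esup>\<close> over
  \<open>(0,t)\<close>, crosses the powers of \<open>2\<close>. On the piece \<open>2\<^sup>k < F \<le> 2\<^sup>k\<^sup>+\<^sup>1\<close>, which starts at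
  \<open>\<tau>\<close>, \<open>P\<^sub>p f\<close> is at most \<open>2\<^sup>k\<^sup>+\<^sup>1 s\<^bsup>-1/p\<^esup>\<close>. The part of \<open>f\<close> on
  the preceding piece has integral \<open>2\<^sup>k\<^sup>-\<^sup>1\<close>, so four times this part reaches the level required by
  the weak type estimate at \<open>\<tau>\<close>. The sum over \<open>k\<close> loses nothing because the pieces are disjoint.\<close>

lemma weak_type_imp_modular_inequality:
  assumes \<Phi>1: "growth_function \<Phi>1" and \<Phi>2: "mono_on {0..} \<Phi>2" "\<Phi>2 0 = 0" and C: "C > 0"
    and weak: "weak_type p \<gamma> \<Phi>1 \<Phi>2 C"
  shows "modular_inequality p \<gamma> \<Phi>1 \<Phi>2"
proof -
  note mono1 = growth_function_mono(1)[OF \<Phi>1]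
  note mono1[measurable] \<Phi>2(1)[measurable]
  define K where "K = max 1 (4 * C)"
  have K: "K \<ge> 1" "K \<ge> 4 * C" by (auto simp: K_def)
  have wk: "scaled_tail p \<gamma> \<Phi>1 l t \<le>
      (\<integral>\<^sup>+s\<in>{0<..<t}. ennreal (\<Phi>2 (C * f s) * s powr \<gamma>) \<partial>leb_pos)"
    if "f \<in> borel_measurable leb_pos" "\<forall>s>0. 0 \<le> f s" "0 < t" "0 < l" "ennreal l \<le> hardy_integral p f t" for f t l
    using weak that unfolding weak_type_def by blast
  show ?thesis unfolding modular_inequality_def measurable_Rplus_iff
  proof (intro exI[of _ K] conjI allI impI)
    show "K > 0" using K by simp
    fix f :: "real \<Rightarrow> real"
    assume f[measurable]: "f \<in> borel_measurable leb_pos" and nn: "\<forall>t>0. 0 \<le> f t"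
    define \<Theta> where "\<Theta> s = extend_top \<Phi>2 (ennreal (K * f s)) * ennreal (s powr \<gamma>)" for s
    have [measurable]: "\<Theta> \<in> borel_measurable leb_pos" unfolding \<Theta>_def by measurable
    have mod2: "modular \<Phi>2 \<gamma> (\<lambda>s. ennreal (K * f s)) = (\<integral>\<^sup>+s. \<Theta> s \<partial>leb_pos)"
      by (simp add: modular_leb_pos \<Theta>_def)
    have \<Theta>_ge: "ennreal (\<Phi>2 (C * (c * f s)) * s powr \<gamma>) \<le> \<Theta> s" if "0 < s" "0 \<le> c" "c \<le> 4" for s c
    proof -
      have "c * C \<le> K" using K(2) that C by (intro order_trans[OF _ K(2)] mult_right_mono) auto
      then have "\<Phi>2 (C * (c * f s)) \<le> \<Phi>2 (K * f s)"
        using that nn C K by (intro mono_onD[OF \<Phi>2(1)]) (auto simp: mult.assoc[symmetric] mult.commute[of C] intro!: mult_right_mono)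
      moreover have "0 \<le> K * f s" using K nn that by simp
      ultimately show ?thesis unfolding \<Theta>_def
        by (auto simp: extend_top_ennreal ennreal_mult'' intro!: mult_right_mono ennreal_leI)
    qed
    show "modular \<Phi>1 \<gamma> (hardy_nn p f) \<le> ennreal K * modular \<Phi>2 \<gamma> (\<lambda>s. ennreal (K * f s))"
    proof (cases "\<exists>t>0. hardy_integral p f t = \<infinity>")
      case True
      then obtain t where t: "t > 0" "hardy_integral p f t = \<infinity>" by auto
      have "(\<integral>\<^sup>+s\<in>{0<..<t}. ennreal (\<Phi>2 (C * f s) * s powr \<gamma>) \<partial>leb_pos) = \<infinity>"
        by (rule scaled_tail_unbounded[OF \<Phi>1 t(1)], rule wk) (use t nn in auto)
      moreover have "(\<integral>\<^sup>+s\<in>{0<..<t}. ennreal (\<Phi>2 (C * f s) * s powr \<gamma>) \<partial>leb_pos) \<le> (\<integral>\<^sup>+s. \<Theta> s \<partial>leb_pos)"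
        using \<Theta>_ge[of _ 1]
        by (intro nn_integral_mono) (auto split: split_indicator simp: space_restrict_space)
      ultimately have "(\<integral>\<^sup>+s. \<Theta> s \<partial>leb_pos) = \<infinity>" by (simp add: top_unique)
      then show ?thesis using K by (simp add: mod2 ennreal_mult_top)
    next
      case False
      define F where "F t = enn2real (hardy_integral p f t)" for t
      have fin: "hardy_integral p f t < \<infinity>" if "t > 0" for t using False that by (auto simp: less_top[symmetric])
      then have F: "hardy_integral p f t = ennreal (F t)" for t
        by (cases "t > 0") (auto simp: F_def hardy_integral_def)
      have F0: "F 0 = 0" by (simp add: F_def hardy_integral_def)
      have F_nn: "0 \<le> F t" for t by (simp add: F_def)
      have F_mono: "mono_on {0..} F"
        using hardy_integral_mono_upper[of _ _ p f] F_nn by (intro mono_onI) (simp add: F)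
      have F_cont: "continuous_on {0..} F"
        unfolding F_def[abs_def] using f nn fin by (rule hardy_integral_continuous)
      have [measurable]: "F \<in> borel_measurable borel"
        unfolding F_def[abs_def]
        by (intro borel_measurable_enn2real borel_measurable_mono_ennreal monoI hardy_integral_mono_upper) 
      \<comment> \<open>All integers \<open>k\<close> are needed, because \<open>F\<close> tends to \<open>0\<close> at \<open>0\<close>.\<close>
      define a :: "int \<Rightarrow> real" where "a k = 2 powr real_of_int k" for k
      have a_pos: "a k > 0" for k by (simp add: a_def)
      have a_Suc: "a (k + 1) = 2 * a k" for k by (simp add: a_def powr_add)
      have a_pred: "a (k - 1) = a k / 2" for k by (simp add: a_def powr_diff)
      define E where "E k = {s. a k < F s \<and> F s \<le> a (k + 1)}" for k
      have E_unique: "j = k" if "s \<in> E j" "s \<in> E k" for s j k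
      proof -
        have "a j < a (k + 1)" "a k < a (j + 1)" using that by (auto simp: E_def)
        then show ?thesis by (simp add: a_def)
      qed
      have E_ex: "\<exists>k. s \<in> E k" if "F s > 0" for s
      proof (intro exI)
        have "real_of_int (\<lceil>log 2 (F s)\<rceil> - 1) < log 2 (F s)" "log 2 (F s) \<le> real_of_int \<lceil>log 2 (F s)\<rceil>"
          by linarith+
        then have "2 powr real_of_int (\<lceil>log 2 (F s)\<rceil> - 1) < F s" "F s \<le> 2 powr real_of_int \<lceil>log 2 (F s)\<rceil>"
          using that by (simp_all only: less_log_iff log_le_iff one_less_numeral_iff semiring_norm)
        then show "s \<in> E (\<lceil>log 2 (F s)\<rceil> - 1)"
          by (simp add: E_def a_def)
      qed
      have E_sum: "(\<integral>\<^sup>+k. g s * indicator (E k) s \<partial>count_space UNIV) = g s" if Fs: "F s > 0" for s and g :: "real \<Rightarrow> ennreal"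
      proof -
        obtain k where k: "s \<in> E k" using E_ex[OF Fs] by blast
        have "(\<integral>\<^sup>+j. g s * indicator (E j) s \<partial>count_space UNIV) =
            (\<integral>\<^sup>+j. g s * indicator {k} j \<partial>count_space UNIV)"
          using k E_unique by (intro nn_integral_cong) (auto split: split_indicator)
        also have "\<dots> = g s" by (subst nn_integral_cmult_indicator) auto
        finally show ?thesis .
      qed
      have E_sum_le: "(\<integral>\<^sup>+k. g s * indicator (E (k - 1)) s \<partial>count_space UNIV) \<le> g s" for s and g :: "real \<Rightarrow> ennreal"
      proof (cases "\<exists>k. s \<in> E (k - 1)")
        case True
        then obtain k where k: "s \<in> E (k - 1)" by auto
        have "(\<integral>\<^sup>+j. g s * indicator (E (j - 1)) s \<partial>count_space UNIV) =
            (\<integral>\<^sup>+j. g s * indicator {k} j \<partial>count_space UNIV)"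
          using k by (intro nn_integral_cong) (auto split: split_indicator dest: E_unique)
        also have "\<dots> = g s" by (subst nn_integral_cmult_indicator) auto
        finally show ?thesis by simp
      next
        case False
        then have "(\<integral>\<^sup>+j. g s * indicator (E (j - 1)) s \<partial>count_space UNIV) = (\<integral>\<^sup>+j. 0 \<partial>count_space (UNIV :: int set))"
          by (intro nn_integral_cong) auto
        then show ?thesis by simp
      qed
      have E_meas[measurable]: "E k \<in> sets borel" for k unfolding E_def by measurable
      define H where "H s = extend_top \<Phi>1 (hardy_nn p f s) * ennreal (s powr \<gamma>)" for s
      have H_meas[measurable]: "H \<in> borel_measurable leb_pos" unfolding H_def by measurable
      have H: "H s = ennreal (\<Phi>1 (F s * s powr (- 1 / p)) * s powr \<gamma>)" for s
      proof -
        have "hardy_nn p f s = ennreal (F s * s powr (- 1 / p))"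
          using F_nn[of s] by (simp add: hardy_nn_hardy_integral F ennreal_mult' mult.commute)
        moreover have "0 \<le> F s * s powr (- 1 / p)" using F_nn[of s] by simp
        ultimately have "extend_top \<Phi>1 (hardy_nn p f s) = ennreal (\<Phi>1 (F s * s powr (- 1 / p)))"
          by (simp only: extend_top_ennreal)
        then show ?thesis by (simp add: H_def ennreal_mult'')
      qed
      have level: "(\<integral>\<^sup>+s. H s * indicator (E k) s \<partial>leb_pos) \<le>
          (\<integral>\<^sup>+s. \<Theta> s * indicator (E (k - 1)) s \<partial>leb_pos)" for k
      proof (cases "\<exists>b>0. a k < F b")
        case False
        then have "(\<integral>\<^sup>+s. H s * indicator (E k) s \<partial>leb_pos) = (\<integral>\<^sup>+s. 0 \<partial>leb_pos)"
          by (intro nn_integral_cong) (auto simp: space_restrict_space E_def split: split_indicator)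
        then show ?thesis by simp
      next
        case True
        then obtain b where b: "b > 0" "a k < F b" by auto
        have "F 0 < a k" using F0 a_pos by simp
        then obtain \<tau> where \<tau>: "0 < \<tau>" "F \<tau> = a k" and \<tau>_iff: "\<And>s. 0 < s \<Longrightarrow> a k < F s \<longleftrightarrow> \<tau> < s"
          using level_point[OF F_cont F_mono _ b] by blast
        have "F 0 < a (k - 1)" "a (k - 1) < F \<tau>"
          using F0 a_pos[of k] \<tau> by (auto simp: a_pred)
        then obtain \<sigma> where \<sigma>: "0 < \<sigma>" "F \<sigma> = a (k - 1)" and \<sigma>_iff: "\<And>s. 0 < s \<Longrightarrow> a (k - 1) < F s \<longleftrightarrow> \<sigma> < s"
          using level_point[OF F_cont F_mono _ \<tau>(1)] by blast
        have "\<sigma> < \<tau>" using \<sigma>_iff[of \<tau>] \<open>a (k - 1) < F \<tau>\<close> \<tau> by simp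
        define h where "h s = 4 * (f s * indicator {\<sigma><..} s)" for s
        have h_meas[measurable]: "h \<in> borel_measurable leb_pos" unfolding h_def by measurable
        have h_nn: "\<forall>s>0. 0 \<le> h s" using nn by (auto simp: h_def)
        have "ennreal (a k) = ennreal (a k / 2) + hardy_integral p (\<lambda>s. f s * indicator {\<sigma><..} s) \<tau>"
          using hardy_integral_split[OF f, of \<sigma> \<tau> p] \<sigma> \<tau> \<open>\<sigma> < \<tau>\<close> by (simp add: F a_pred)
        then have "hardy_integral p (\<lambda>s. f s * indicator {\<sigma><..} s) \<tau> = ennreal (a k / 2)"
          using a_pos[of k] by (cases "hardy_integral p (\<lambda>s. f s * indicator {\<sigma><..} s) \<tau>" rule: ennreal_cases)
            (auto simp: ennreal_plus[symmetric] simp del: ennreal_plus)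
        then have cum_h: "hardy_integral p h \<tau> = ennreal (a (k + 1))"
          unfolding h_def[abs_def] using a_pos[of k]
          by (subst hardy_integral_cmult) (auto simp: a_Suc ennreal_mult'[symmetric] simp flip: ennreal_numeral)
        have "(\<integral>\<^sup>+s. H s * indicator (E k) s \<partial>leb_pos) \<le>
            scaled_tail p \<gamma> \<Phi>1 (a (k + 1)) \<tau>"
          unfolding scaled_tail_def
        proof (rule nn_integral_mono)
          fix s assume "s \<in> space leb_pos"
          then have s: "s > 0" by (simp add: space_restrict_space)
          show "H s * indicator (E k) s \<le>
              ennreal (\<Phi>1 (a (k + 1) * s powr (- 1 / p)) * s powr \<gamma>) * indicator {\<tau><..} s"
            using \<tau>_iff[OF s] F_nn[of s] a_pos[of "k + 1"] unfolding H E_def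
            by (auto split: split_indicator intro!: ennreal_leI mult_right_mono mono_onD[OF mono1])
        qed
        also have "\<dots> \<le> (\<integral>\<^sup>+s\<in>{0<..<\<tau>}. ennreal (\<Phi>2 (C * h s) * s powr \<gamma>) \<partial>leb_pos)"
          using cum_h by (intro wk h_meas h_nn \<tau> a_pos) simp
        also have "\<dots> \<le> (\<integral>\<^sup>+s. \<Theta> s * indicator (E (k - 1)) s \<partial>leb_pos)"
        proof (rule nn_integral_mono)
          fix s assume "s \<in> space leb_pos"
          then have s: "s > 0" by (simp add: space_restrict_space)
          show "ennreal (\<Phi>2 (C * h s) * s powr \<gamma>) * indicator {0<..<\<tau>} s \<le>
              \<Theta> s * indicator (E (k - 1)) s"
          proof (cases "\<sigma> < s \<and> s < \<tau>")
            case True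
            then have "s \<in> E (k - 1)" using \<sigma>_iff[OF s] \<tau>_iff[OF s] by (auto simp: E_def)
            then show ?thesis using \<Theta>_ge[OF s, of 4] True s by (simp add: h_def)
          qed (auto simp: h_def \<Phi>2(2) split: split_indicator)
        qed
        finally show ?thesis .
      qed
      have "modular \<Phi>1 \<gamma> (hardy_nn p f) = (\<integral>\<^sup>+s. H s \<partial>leb_pos)"
        by (simp add: modular_leb_pos H_def)
      also have "\<dots> = (\<integral>\<^sup>+s. \<integral>\<^sup>+k. H s * indicator (E k) s \<partial>count_space UNIV \<partial>leb_pos)"
      proof (rule nn_integral_cong)
        fix s assume "s \<in> space leb_pos"
        show "H s = (\<integral>\<^sup>+k. H s * indicator (E k) s \<partial>count_space UNIV)"
        proof (cases "F s = 0")
          case True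
          then show ?thesis by (simp add: H growth_function_mono(2)[OF \<Phi>1])
        next
          case False
          then show ?thesis using E_sum[of s H] F_nn[of s] by simp
        qed
      qed
      also have "\<dots> = (\<integral>\<^sup>+k. \<integral>\<^sup>+s. H s * indicator (E k) s \<partial>leb_pos \<partial>count_space UNIV)"
        by (rule nn_integral_count_space_nn_integral) auto
      also have "\<dots> \<le> (\<integral>\<^sup>+k. \<integral>\<^sup>+s. \<Theta> s * indicator (E (k - 1)) s \<partial>leb_pos \<partial>count_space UNIV)"
        by (intro nn_integral_mono level)
      also have "\<dots> = (\<integral>\<^sup>+s. \<integral>\<^sup>+k. \<Theta> s * indicator (E (k - 1)) s \<partial>count_space UNIV \<partial>leb_pos)"
        by (rule nn_integral_count_space_nn_integral[symmetric]) auto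
      also have "\<dots> \<le> (\<integral>\<^sup>+s. \<Theta> s \<partial>leb_pos)"
        by (intro nn_integral_mono E_sum_le)
      also have "\<dots> \<le> ennreal K * (\<integral>\<^sup>+s. \<Theta> s \<partial>leb_pos)"
        using K mult_right_mono[of 1 "ennreal K" "\<integral>\<^sup>+s. \<Theta> s \<partial>leb_pos"] by simp
      finally show ?thesis by (simp add: mod2)
    qed
  qed
qed

section \<open>The integral conditions for a Young function\<close>

lemma tail_alpha_eq: "0 < t \<Longrightarrow> tail_alpha p \<gamma> \<Phi> t = scaled_tail p \<gamma> \<Phi> 1 t"
  unfolding tail_alpha_def scaled_tail_def by (subst set_nn_integral_leb_pos) auto

text \<open>The level \<open>l\<close> is absorbed by the substitution \<open>s \<mapsto> l\<^sup>p s\<close>, which is where \<open>p \<noteq> 0\<close> is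
  needed.\<close>

lemma scaled_tail_dilate:
  assumes \<Phi>: "mono_on {0..} \<Phi>" and p: "p \<noteq> 0" and l: "0 < l"
  shows "scaled_tail p \<gamma> \<Phi> l t =
    ennreal ((l powr p) powr (\<gamma> + 1)) * scaled_tail p \<gamma> \<Phi> 1 (t / l powr p)"
proof -
  define c where "c = l powr p"
  have c: "c > 0" using l by (simp add: c_def)
  have lc: "l * (c * s) powr (- 1 / p) = s powr (- 1 / p)" for s
    using l p by (simp add: c_def powr_mult powr_powr powr_minus field_simps)
  have [measurable]: "(\<lambda>s. \<Phi> (l * s powr a)) \<in> borel_measurable leb_pos" for a :: real
  proof (rule measurable_mono_on_compose[OF \<Phi>])
    show "l * s powr a \<in> {0..}" for s using l by (simp add: less_imp_le)
  qed measurable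
  have [measurable]: "(\<lambda>s. \<Phi> (s powr a)) \<in> borel_measurable leb_pos" for a :: real
    by (rule measurable_mono_on_compose[OF \<Phi>]) simp_all
  have "scaled_tail p \<gamma> \<Phi> l t = ennreal c *
      (\<integral>\<^sup>+s. ennreal (\<Phi> (l * (c * s) powr (- 1 / p)) * (c * s) powr \<gamma>) * indicator {t<..} (c * s) \<partial>leb_pos)"
    unfolding scaled_tail_def by (rule nn_integral_dilate[OF _ c]) measurable
  also have "(\<integral>\<^sup>+s. ennreal (\<Phi> (l * (c * s) powr (- 1 / p)) * (c * s) powr \<gamma>) * indicator {t<..} (c * s) \<partial>leb_pos) =
      (\<integral>\<^sup>+s. ennreal (c powr \<gamma>) *
        (ennreal (\<Phi> (s powr (- 1 / p)) * s powr \<gamma>) * indicator {t / c<..} s) \<partial>leb_pos)"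
  proof (rule nn_integral_cong)
    fix s assume "s \<in> space leb_pos"
    then have "s > 0" by (simp add: space_restrict_space)
    moreover have "t < c * s \<longleftrightarrow> t / c < s" using c by (simp add: field_simps)
    ultimately show "ennreal (\<Phi> (l * (c * s) powr (- 1 / p)) * (c * s) powr \<gamma>) * indicator {t<..} (c * s) =
        ennreal (c powr \<gamma>) *
        (ennreal (\<Phi> (s powr (- 1 / p)) * s powr \<gamma>) * indicator {t / c<..} s)"
      unfolding lc using c
      by (auto split: split_indicator simp: powr_mult ennreal_mult'[symmetric] mult_ac)
  qed
  also have "\<dots> = ennreal (c powr \<gamma>) * scaled_tail p \<gamma> \<Phi> 1 (t / c)"
    unfolding scaled_tail_def mult_1 by (rule nn_integral_cmult) measurable
  also have "ennreal c * (ennreal (c powr \<gamma>) * scaled_tail p \<gamma> \<Phi> 1 (t / c)) =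
      ennreal (c powr (\<gamma> + 1)) * scaled_tail p \<gamma> \<Phi> 1 (t / c)"
    using c by (simp add: powr_add mult.assoc[symmetric] ennreal_mult'[symmetric] mult.commute)
  finally show ?thesis by (simp add: c_def)
qed

text \<open>Dilating \<open>f\<close> by \<open>l\<^sup>p\<close> changes the level from \<open>l\<close> to \<open>1\<close>, and both sides of the estimate
  are multiplied by the same power of \<open>l\<close>.\<close>

lemma weak_type_of_unit_level:
  assumes \<Phi>1: "mono_on {0..} \<Phi>1" and \<Phi>2: "mono_on {0..} \<Phi>2" and p: "p \<noteq> 0" and C: "0 < C"
    and unit: "\<And>f t. f \<in> borel_measurable leb_pos \<Longrightarrow> \<forall>s>0. 0 \<le> f s \<Longrightarrow> 0 < t \<Longrightarrow>
      1 \<le> hardy_integral p f t \<Longrightarrow> scaled_tail p \<gamma> \<Phi>1 1 t \<le>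
      (\<integral>\<^sup>+s\<in>{0<..<t}. ennreal (\<Phi>2 (C * f s) * s powr \<gamma>) \<partial>leb_pos)"
  shows "weak_type p \<gamma> \<Phi>1 \<Phi>2 C"
  unfolding weak_type_def
proof (intro allI impI)
  fix f :: "real \<Rightarrow> real" and t l :: real
  assume f[measurable]: "f \<in> borel_measurable leb_pos" and nn: "\<forall>s>0. 0 \<le> f s" and t: "0 < t"
    and l: "0 < l" and le: "ennreal l \<le> hardy_integral p f t"
  define c where "c = l powr p"
  have c: "c > 0" using l by (simp add: c_def)
  have c_root: "c powr (1 / p) = l" using l p by (simp add: c_def powr_powr)
  have [measurable]: "(\<lambda>s. \<Phi>2 (C * f s)) \<in> borel_measurable leb_pos"
    using nn C by (intro measurable_mono_on_compose[OF \<Phi>2]) (auto simp: space_restrict_space)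
  have fc[measurable]: "(\<lambda>s. f (c * s)) \<in> borel_measurable leb_pos"
    by (rule measurable_dilate[OF f c])
  have [measurable]: "(\<lambda>s. \<Phi>2 (C * f (c * s))) \<in> borel_measurable leb_pos"
    using nn C c by (intro measurable_mono_on_compose[OF \<Phi>2]) (auto simp: space_restrict_space)
  have "ennreal l * 1 \<le> ennreal l * hardy_integral p (\<lambda>s. f (c * s)) (t / c)"
    using le hardy_integral_dilate[OF f c, of "t / c" p] t c by (simp add: c_root)
  then have "1 \<le> hardy_integral p (\<lambda>s. f (c * s)) (t / c)"
    using l by (subst (asm) ennreal_mult_le_mult_iff) auto
  then have tail: "scaled_tail p \<gamma> \<Phi>1 1 (t / c) \<le>
      (\<integral>\<^sup>+s\<in>{0<..<t / c}. ennreal (\<Phi>2 (C * f (c * s)) * s powr \<gamma>) \<partial>leb_pos)"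
    using nn t c by (intro unit fc) auto
  have "(\<integral>\<^sup>+s\<in>{0<..<t}. ennreal (\<Phi>2 (C * f s) * s powr \<gamma>) \<partial>leb_pos) = ennreal c *
      (\<integral>\<^sup>+s. ennreal (\<Phi>2 (C * f (c * s)) * (c * s) powr \<gamma>) * indicator {0<..<t} (c * s) \<partial>leb_pos)"
    by (rule nn_integral_dilate[OF _ c]) measurable
  also have "(\<integral>\<^sup>+s. ennreal (\<Phi>2 (C * f (c * s)) * (c * s) powr \<gamma>) * indicator {0<..<t} (c * s) \<partial>leb_pos) =
      (\<integral>\<^sup>+s. ennreal (c powr \<gamma>) *
        (ennreal (\<Phi>2 (C * f (c * s)) * s powr \<gamma>) * indicator {0<..<t / c} s) \<partial>leb_pos)"
  proof (rule nn_integral_cong)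
    fix s assume "s \<in> space leb_pos"
    then have "s > 0" by (simp add: space_restrict_space)
    moreover have "c * s < t \<longleftrightarrow> s < t / c" using c by (simp add: field_simps)
    ultimately show "ennreal (\<Phi>2 (C * f (c * s)) * (c * s) powr \<gamma>) * indicator {0<..<t} (c * s) =
        ennreal (c powr \<gamma>) *
        (ennreal (\<Phi>2 (C * f (c * s)) * s powr \<gamma>) * indicator {0<..<t / c} s)"
      using c by (auto split: split_indicator simp: powr_mult ennreal_mult'[symmetric] mult_ac)
  qed
  also have "\<dots> = ennreal (c powr \<gamma>) *
      (\<integral>\<^sup>+s\<in>{0<..<t / c}. ennreal (\<Phi>2 (C * f (c * s)) * s powr \<gamma>) \<partial>leb_pos)"
    by (rule nn_integral_cmult) measurable
  finally have "(\<integral>\<^sup>+s\<in>{0<..<t}. ennreal (\<Phi>2 (C * f s) * s powr \<gamma>) \<partial>leb_pos) = ennreal (c powr (\<gamma> + 1)) *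
      (\<integral>\<^sup>+s\<in>{0<..<t / c}. ennreal (\<Phi>2 (C * f (c * s)) * s powr \<gamma>) \<partial>leb_pos)"
    using c by (simp add: powr_add mult.assoc[symmetric] ennreal_mult'[symmetric] mult.commute)
  then show "scaled_tail p \<gamma> \<Phi>1 l t \<le> (\<integral>\<^sup>+s\<in>{0<..<t}. ennreal (\<Phi>2 (C * f s) * s powr \<gamma>) \<partial>leb_pos)"
    using tail unfolding scaled_tail_dilate[OF \<Phi>1 p l] c_def[symmetric] by (simp add: mult_left_mono)
qed

text \<open>A Young function vanishes near \<open>0\<close> if its density does, so \<open>\<Phi>2\<close> is described by its density
  and not by \<open>growth_function\<close>.\<close>

locale hardy_young =
  fixes p \<gamma> :: real and \<Phi>1 \<Phi>2 \<phi> :: "real \<Rightarrow> real"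
  assumes \<Phi>1: "growth_function \<Phi>1" and young: "young_density \<phi>"
    and \<Phi>2: "\<And>t. 0 \<le> t \<Longrightarrow> \<Phi>2 t = primitive \<phi> t"
begin

abbreviation \<psi> where "\<psi> \<equiv> generalized_inverse \<phi>"
abbreviation \<alpha> where "\<alpha> t \<equiv> enn2real (tail_alpha p \<gamma> \<Phi>1 t)"

text \<open>The argument at which the complementary function and the generalized inverse are evaluated in
  the two integral conditions.\<close>

definition slope :: "real \<Rightarrow> real \<Rightarrow> real \<Rightarrow> real" where
  "slope C t s = \<alpha> t / (C * s powr (1 - 1 / p + \<gamma>))"

lemmas \<phi>_mono = young_density_mono[OF young]
  and \<phi>_nonneg = young_density_nonneg[OF young]
  and \<Phi>1_mono = growth_function_mono(1)[OF \<Phi>1]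

lemma \<Phi>2_mono: "mono_on {0..} \<Phi>2"
  using primitive_mono[OF \<phi>_mono \<phi>_nonneg] by (simp add: mono_on_def \<Phi>2)

lemma \<Phi>2_0: "\<Phi>2 0 = 0" by (simp add: \<Phi>2 primitive_0[OF \<phi>_mono \<phi>_nonneg])

text \<open>Positivity of the tail makes the slope positive. At \<open>0\<close> the generalized inverse may be the
  supremum of the empty set.\<close>

lemma tail_pos:
  assumes "0 < t" "tail_alpha p \<gamma> \<Phi>1 t < \<infinity>"
  shows "0 < \<alpha> t" and "tail_alpha p \<gamma> \<Phi>1 t = ennreal (\<alpha> t)"
proof -
  obtain m w where mw: "0 < m" "0 < w" "ennreal (\<Phi>1 (1 * m) * w) \<le> scaled_tail p \<gamma> \<Phi>1 1 t"
    using scaled_tail_lower[OF growth_function_mono(1,3)[OF \<Phi>1] assms(1)] zero_less_one by metis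
  have "0 < ennreal (\<Phi>1 (1 * m) * w)"
    using mw(1,2) growth_function_mono(4)[OF \<Phi>1, of m] by simp
  also note mw(3)
  finally show "0 < \<alpha> t" using assms by (simp add: enn2real_positive_iff tail_alpha_eq)
  show "tail_alpha p \<gamma> \<Phi>1 t = ennreal (\<alpha> t)" using assms(2) by simp
qed

lemma slope_pos: "0 < \<alpha> t \<Longrightarrow> 0 < C \<Longrightarrow> 0 < s \<Longrightarrow> 0 < slope C t s"
  by (simp add: slope_def)

text \<open>The exponent in \<open>slope\<close> is chosen so that \<open>slope C t s * f s\<close>, integrated against
  \<open>s\<^sup>\<gamma>\<close>, is a constant multiple of the integral that defines \<open>P\<^sub>p f\<close>.\<close>

lemma slope_weight:
  assumes "0 < s" shows "slope C t s * s powr \<gamma> = \<alpha> t / C * s powr (1 / p - 1)"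
proof -
  define d where "d = s powr (1 - 1 / p + \<gamma>)"
  have d: "d > 0" using assms by (simp add: d_def)
  have weight: "s powr \<gamma> = s powr (1 / p - 1) * d"
    by (simp add: d_def powr_add[symmetric])
  show ?thesis unfolding slope_def weight d_def[symmetric] using d by simp
qed

lemma slope_half: "2 * slope (2 * C) t s = slope C t s"
  by (simp add: slope_def)

lemma slope_measurable [measurable]: "slope C t \<in> borel_measurable leb_pos"
  unfolding slope_def[abs_def] by measurable

lemma inverse_slope_measurable:
  assumes "0 < \<alpha> t" "0 < C"
  shows "(\<lambda>s. \<psi> (slope C t s)) \<in> borel_measurable leb_pos"
  using slope_pos[OF assms]
  by (intro measurable_mono_on_compose[OF generalized_inverse_mono[OF young]])
    (auto simp: space_restrict_space)

definition inverse_integral :: "real \<Rightarrow> real \<Rightarrow> ennreal" where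
  "inverse_integral C t = (\<integral>\<^sup>+s\<in>{0<..<t}. ennreal (\<psi> (slope C t s) * s powr (1 / p - 1)) \<partial>leb_pos)"

lemma bloom_kerman_density_iff:
  "bloom_kerman_density p \<gamma> \<Phi>1 \<phi> \<longleftrightarrow>
    (\<exists>C>0. \<forall>t>0. inverse_integral C t \<le> ennreal C \<and> tail_alpha p \<gamma> \<Phi>1 t < \<infinity>)"
  unfolding bloom_kerman_density_def inverse_integral_def slope_def
  by (subst set_nn_integral_leb_pos) auto

lemma bloom_kerman_iff:
  "bloom_kerman p \<gamma> \<Phi>1 \<phi> \<longleftrightarrow>
    (\<exists>C>0. \<forall>t>0. (\<integral>\<^sup>+s\<in>{0<..<t}. ennreal (complementary \<phi> (slope C t s) * s powr \<gamma>) \<partial>leb_pos)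
      \<le> tail_alpha p \<gamma> \<Phi>1 t \<and> tail_alpha p \<gamma> \<Phi>1 t < \<infinity>)"
  unfolding bloom_kerman_def slope_def
  by (subst set_nn_integral_leb_pos) auto

lemma inverse_integral_weighted:
  assumes "0 < \<alpha> t" "0 < C"
  shows "(\<integral>\<^sup>+s\<in>{0<..<t}. ennreal (slope C t s * \<psi> (slope C t s) * s powr \<gamma>) \<partial>leb_pos) =
    ennreal (\<alpha> t / C) * inverse_integral C t"
proof -
  note inverse_slope_measurable[OF assms, measurable]
  have "(\<integral>\<^sup>+s\<in>{0<..<t}. ennreal (slope C t s * \<psi> (slope C t s) * s powr \<gamma>) \<partial>leb_pos) =
      (\<integral>\<^sup>+s. ennreal (\<alpha> t / C) * (ennreal (\<psi> (slope C t s) * s powr (1 / p - 1)) * indicator {0<..<t} s) \<partial>leb_pos)"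
  proof (rule nn_integral_cong)
    fix s assume "s \<in> space leb_pos"
    then have s: "0 < s" by (simp add: space_restrict_space)
    have "slope C t s * \<psi> (slope C t s) * s powr \<gamma> = (slope C t s * s powr \<gamma>) * \<psi> (slope C t s)"
      by (simp add: mult_ac)
    also have "\<dots> = \<alpha> t / C * (\<psi> (slope C t s) * s powr (1 / p - 1))"
      unfolding slope_weight[OF s] by (simp add: mult_ac)
    finally have "slope C t s * \<psi> (slope C t s) * s powr \<gamma> = \<alpha> t / C * (\<psi> (slope C t s) * s powr (1 / p - 1))" .
    moreover have "0 \<le> \<alpha> t / C" using assms by simp
    ultimately show "ennreal (slope C t s * \<psi> (slope C t s) * s powr \<gamma>) * indicator {0<..<t} s =
        ennreal (\<alpha> t / C) * (ennreal (\<psi> (slope C t s) * s powr (1 / p - 1)) * indicator {0<..<t} s)"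
      by (simp only: ennreal_mult' mult.assoc)
  qed
  also have "\<dots> = ennreal (\<alpha> t / C) * inverse_integral C t"
    unfolding inverse_integral_def by (rule nn_integral_cmult) measurable
  finally show ?thesis .
qed

text \<open>Both directions integrate one half of \<open>\<Psi>(b) \<le> b \<psi>(b) \<le> \<Psi>(2 b)\<close> with \<open>b\<close> equal to the slope;
  the factor \<open>2\<close> is paid by doubling \<open>C\<close>.\<close>

lemma bloom_kerman_iff_density: "bloom_kerman p \<gamma> \<Phi>1 \<phi> \<longleftrightarrow> bloom_kerman_density p \<gamma> \<Phi>1 \<phi>"
proof
  assume "bloom_kerman_density p \<gamma> \<Phi>1 \<phi>"
  then obtain C where C: "C > 0" and le: "\<And>t. t > 0 \<Longrightarrow> inverse_integral C t \<le> ennreal C"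
    and fin: "\<And>t. t > 0 \<Longrightarrow> tail_alpha p \<gamma> \<Phi>1 t < \<infinity>"
    unfolding bloom_kerman_density_iff by blast
  have "(\<integral>\<^sup>+s\<in>{0<..<t}. ennreal (complementary \<phi> (slope C t s) * s powr \<gamma>) \<partial>leb_pos) \<le>
      tail_alpha p \<gamma> \<Phi>1 t" if t: "t > 0" for t
  proof -
    note a = tail_pos[OF t fin[OF t]]
    have "(\<integral>\<^sup>+s\<in>{0<..<t}. ennreal (complementary \<phi> (slope C t s) * s powr \<gamma>) \<partial>leb_pos) \<le>
        (\<integral>\<^sup>+s\<in>{0<..<t}. ennreal (slope C t s * \<psi> (slope C t s) * s powr \<gamma>) \<partial>leb_pos)"
      using complementary_upper[OF young slope_pos[OF a(1) C]]
      by (intro nn_integral_mono)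
        (auto split: split_indicator intro!: ennreal_leI mult_right_mono)
    also have "\<dots> = ennreal (\<alpha> t / C) * inverse_integral C t" by (rule inverse_integral_weighted[OF a(1) C])
    also have "\<dots> \<le> ennreal (\<alpha> t / C) * ennreal C" by (intro mult_left_mono le t) auto
    also have "\<dots> = tail_alpha p \<gamma> \<Phi>1 t"
      using a C by (subst a(2)) (simp add: ennreal_mult'[symmetric])
    finally show ?thesis .
  qed
  then show "bloom_kerman p \<gamma> \<Phi>1 \<phi>" unfolding bloom_kerman_iff using C fin by blast
next
  assume "bloom_kerman p \<gamma> \<Phi>1 \<phi>"
  then obtain C where C: "C > 0"
    and le: "\<And>t. t > 0 \<Longrightarrow> (\<integral>\<^sup>+s\<in>{0<..<t}. ennreal (complementary \<phi> (slope C t s) * s powr \<gamma>) \<partial>leb_pos) \<le> tail_alpha p \<gamma> \<Phi>1 t"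
    and fin: "\<And>t. t > 0 \<Longrightarrow> tail_alpha p \<gamma> \<Phi>1 t < \<infinity>"
    unfolding bloom_kerman_iff by blast
  have C2: "2 * C > 0" using C by simp
  have "inverse_integral (2 * C) t \<le> ennreal (2 * C)" if t: "t > 0" for t
  proof -
    note a = tail_pos[OF t fin[OF t]]
    have "ennreal (\<alpha> t / (2 * C)) * inverse_integral (2 * C) t =
        (\<integral>\<^sup>+s\<in>{0<..<t}. ennreal (slope (2 * C) t s * \<psi> (slope (2 * C) t s) * s powr \<gamma>) \<partial>leb_pos)"
      by (rule inverse_integral_weighted[OF a(1) C2, symmetric])
    also have "\<dots> \<le> (\<integral>\<^sup>+s\<in>{0<..<t}. ennreal (complementary \<phi> (slope C t s) * s powr \<gamma>) \<partial>leb_pos)"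
      using complementary_lower[OF young slope_pos[OF a(1) C2]]
      by (intro nn_integral_mono)
        (auto split: split_indicator simp: slope_half intro!: ennreal_leI mult_right_mono)
    also have "\<dots> \<le> tail_alpha p \<gamma> \<Phi>1 t" by (rule le[OF t])
    also have "\<dots> = ennreal (\<alpha> t / (2 * C)) * ennreal (2 * C)"
      using a C by (subst a(2)) (simp add: ennreal_mult'[symmetric])
    finally show ?thesis using a C by (subst (asm) ennreal_mult_le_mult_iff) auto
  qed
  then show "bloom_kerman_density p \<gamma> \<Phi>1 \<phi>" unfolding bloom_kerman_density_iff using C2 fin by blast
qed

text \<open>The weak type estimate at level \<open>1\<close>. With \<open>b\<close> the slope, either
  \<open>2 C f \<le> \<psi>(b)\<close>, and then \<open>f\<close> is controlled by the density condition, which contributes at most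
  \<open>1/2\<close> to the integral of \<open>f(s) s\<^bsup>1/p-1\<^esup>\<close>; or \<open>2 C f > \<psi>(b)\<close>, and then
  \<open>2 C f b \<le> \<Phi>2(4 C f)\<close>. Since the integral is at least \<open>1\<close>, the second alternative must contribute at
  least \<open>1/2\<close>, which is the estimate.\<close>

lemma density_imp_modular_inequality:
  assumes p: "p \<noteq> 0" and BK: "bloom_kerman_density p \<gamma> \<Phi>1 \<phi>"
  shows "modular_inequality p \<gamma> \<Phi>1 \<Phi>2"
proof -
  obtain C where C: "C > 0" and le: "\<And>t. t > 0 \<Longrightarrow> inverse_integral C t \<le> ennreal C"
    and fin: "\<And>t. t > 0 \<Longrightarrow> tail_alpha p \<gamma> \<Phi>1 t < \<infinity>"
    using BK unfolding bloom_kerman_density_iff by blast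
  have "weak_type p \<gamma> \<Phi>1 \<Phi>2 (4 * C)"
  proof (rule weak_type_of_unit_level[OF \<Phi>1_mono \<Phi>2_mono p])
    show "0 < 4 * C" using C by simp
    fix f :: "real \<Rightarrow> real" and t :: real
    assume f[measurable]: "f \<in> borel_measurable leb_pos" and nn: "\<forall>s>0. 0 \<le> f s" and t: "0 < t"
      and ge: "1 \<le> hardy_integral p f t"
    note a = tail_pos[OF t fin[OF t]]
    note inverse_slope_measurable[OF a(1) C, measurable]
    have [measurable]: "(\<lambda>s. \<Phi>2 (4 * C * f s)) \<in> borel_measurable leb_pos"
      using nn C by (intro measurable_mono_on_compose[OF \<Phi>2_mono]) (auto simp: space_restrict_space)
    define X where "X = (\<integral>\<^sup>+s\<in>{0<..<t}. ennreal (\<Phi>2 (4 * C * f s) * s powr \<gamma>) \<partial>leb_pos)"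
    have pointwise: "f s * s powr (1 / p - 1) \<le> 1 / (2 * C) * (\<psi> (slope C t s) * s powr (1 / p - 1)) +
        1 / (2 * \<alpha> t) * (\<Phi>2 (4 * C * f s) * s powr \<gamma>)" if s: "0 < s" for s
    proof -
      define b where "b = slope C t s"
      have b: "0 < b" using slope_pos[OF a(1) C s] by (simp add: b_def)
      have \<Phi>2_nn: "0 \<le> \<Phi>2 (4 * C * f s)"
        using nn C s by (subst \<Phi>2) (auto intro!: primitive_nonneg[OF \<phi>_mono \<phi>_nonneg])
      show ?thesis
      proof (cases "2 * C * f s \<le> \<psi> b")
        case True
        then have "f s * s powr (1 / p - 1) \<le> 1 / (2 * C) * \<psi> b * s powr (1 / p - 1)"
          using C by (intro mult_right_mono) (auto simp: field_simps)
        moreover have "0 \<le> 1 / (2 * \<alpha> t) * (\<Phi>2 (4 * C * f s) * s powr \<gamma>)" using \<Phi>2_nn a by simp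
        ultimately show ?thesis by (simp add: b_def)
      next
        case False
        then have "0 < 2 * C * f s" using generalized_inverse_pos[OF young b] by linarith
        then have "2 * C * f s * b \<le> primitive \<phi> (2 * (2 * C * f s))"
          using mult_le_primitive_beyond_inverse[OF young, of "2 * C * f s" b] False by simp
        also have "\<dots> = \<Phi>2 (4 * C * f s)"
          using \<open>0 < 2 * C * f s\<close> by (simp add: \<Phi>2 mult.assoc)
        finally have "2 * C * f s * b * s powr \<gamma> \<le> \<Phi>2 (4 * C * f s) * s powr \<gamma>"
          by (rule mult_right_mono) simp
        also have "2 * C * f s * b * s powr \<gamma> = 2 * \<alpha> t * (f s * s powr (1 / p - 1))"
          using slope_weight[OF s, of C t] C by (simp add: b_def field_simps)
        finally have "f s * s powr (1 / p - 1) \<le> 1 / (2 * \<alpha> t) * (\<Phi>2 (4 * C * f s) * s powr \<gamma>)"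
          using a(1) by (simp add: field_simps)
        moreover have "0 \<le> 1 / (2 * C) * (\<psi> (slope C t s) * s powr (1 / p - 1))"
          using generalized_inverse_pos[OF young b] C by (simp add: b_def)
        ultimately show ?thesis by linarith
      qed
    qed
    have "1 \<le> hardy_integral p f t" by (rule ge)
    also have "\<dots> \<le> (\<integral>\<^sup>+s. ennreal (1 / (2 * C)) * (ennreal (\<psi> (slope C t s) * s powr (1 / p - 1)) * indicator {0<..<t} s) +
        ennreal (1 / (2 * \<alpha> t)) * (ennreal (\<Phi>2 (4 * C * f s) * s powr \<gamma>) * indicator {0<..<t} s) \<partial>leb_pos)"
      unfolding hardy_integral_def
    proof (rule nn_integral_mono)
      fix s assume "s \<in> space leb_pos"
      then have s: "0 < s" by (simp add: space_restrict_space)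
      have nonneg: "0 \<le> \<psi> (slope C t s)" "0 \<le> \<Phi>2 (4 * C * f s)"
        using generalized_inverse_nonneg[OF young slope_pos[OF a(1) C s]] nn C s
        by (auto simp: \<Phi>2 intro!: primitive_nonneg[OF \<phi>_mono \<phi>_nonneg])
      have split: "ennreal (u * x + v * y) = ennreal u * ennreal x + ennreal v * ennreal y"
        if "0 \<le> u" "0 \<le> x" "0 \<le> v" "0 \<le> y" for u v x y :: real
        using that by (simp add: ennreal_mult)
      have "ennreal (f s * s powr (1 / p - 1)) \<le> ennreal (1 / (2 * C) * (\<psi> (slope C t s) * s powr (1 / p - 1)) +
          1 / (2 * \<alpha> t) * (\<Phi>2 (4 * C * f s) * s powr \<gamma>))"
        by (rule ennreal_leI[OF pointwise[OF s]])
      also have "\<dots> = ennreal (1 / (2 * C)) * ennreal (\<psi> (slope C t s) * s powr (1 / p - 1)) +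
          ennreal (1 / (2 * \<alpha> t)) * ennreal (\<Phi>2 (4 * C * f s) * s powr \<gamma>)"
        using C a(1) nonneg by (intro split) auto
      finally show "ennreal (f s * s powr (1 / p - 1)) * indicator {0<..<t} s \<le>
          ennreal (1 / (2 * C)) * (ennreal (\<psi> (slope C t s) * s powr (1 / p - 1)) * indicator {0<..<t} s) +
          ennreal (1 / (2 * \<alpha> t)) * (ennreal (\<Phi>2 (4 * C * f s) * s powr \<gamma>) * indicator {0<..<t} s)"
        by (auto split: split_indicator)
    qed
    also have "\<dots> = ennreal (1 / (2 * C)) * inverse_integral C t + ennreal (1 / (2 * \<alpha> t)) * X"
      unfolding inverse_integral_def X_def
      by (subst nn_integral_add) (measurable, subst (1 2) nn_integral_cmult, measurable)
    also have "\<dots> \<le> ennreal (1 / (2 * C)) * ennreal C + ennreal (1 / (2 * \<alpha> t)) * X"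
      by (intro add_mono mult_left_mono le t) auto
    also have "ennreal (1 / (2 * C)) * ennreal C = ennreal (1 / 2)"
      using C by (simp add: ennreal_mult'[symmetric])
    finally have sum: "1 \<le> ennreal (1 / 2) + ennreal (1 / (2 * \<alpha> t)) * X" .
    have "ennreal (\<alpha> t) \<le> X"
    proof (cases X rule: ennreal_cases)
      case (real x)
      have nn: "0 \<le> 1 / (2 * \<alpha> t)" by simp
      have "1 \<le> ennreal (1 / 2) + ennreal (1 / (2 * \<alpha> t) * x)"
        using sum nn unfolding \<open>X = ennreal x\<close> by (simp only: ennreal_mult')
      also have "\<dots> = ennreal (1 / 2 + 1 / (2 * \<alpha> t) * x)"
        by (rule ennreal_plus[symmetric]) (use real nn in auto)
      finally have "1 \<le> 1 / 2 + 1 / (2 * \<alpha> t) * x"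
        by (simp only: ennreal_1[symmetric] ennreal_le_iff2) auto
      then show ?thesis using a(1) real by (simp add: field_simps ennreal_leI)
    qed simp
    then show "scaled_tail p \<gamma> \<Phi>1 1 t \<le> (\<integral>\<^sup>+s\<in>{0<..<t}. ennreal (\<Phi>2 (4 * C * f s) * s powr \<gamma>) \<partial>leb_pos)"
      using a(2) t by (simp add: X_def tail_alpha_eq)
  qed
  then show ?thesis
    using C by (intro weak_type_imp_modular_inequality[OF \<Phi>1 \<Phi>2_mono \<Phi>2_0]) auto
qed

lemma tail_le_modular_hardy:
  assumes t: "0 < t" and ge: "1 \<le> hardy_integral p f t"
  shows "tail_alpha p \<gamma> \<Phi>1 t \<le> modular \<Phi>1 \<gamma> (hardy_nn p f)"
  unfolding tail_alpha_eq[OF t] scaled_tail_def modular_leb_pos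
proof (rule nn_integral_mono)
  fix s
  show "ennreal (\<Phi>1 (1 * s powr (- 1 / p)) * s powr \<gamma>) * indicator {t<..} s \<le>
      extend_top \<Phi>1 (hardy_nn p f s) * ennreal (s powr \<gamma>)"
  proof (cases "t < s")
    case True
    have "1 \<le> hardy_integral p f s" using ge hardy_integral_mono_upper[of t s p f] True by (auto intro: order_trans)
    then have "ennreal (s powr (- 1 / p)) * 1 \<le> hardy_nn p f s"
      unfolding hardy_nn_hardy_integral by (intro mult_left_mono) auto
    then have "extend_top \<Phi>1 (ennreal (s powr (- 1 / p))) \<le> extend_top \<Phi>1 (hardy_nn p f s)"
      by (intro extend_top_mono[OF \<Phi>1_mono]) simp
    then show ?thesis using True by (simp add: extend_top_ennreal ennreal_mult'' mult_right_mono)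
  qed simp
qed

text \<open>Finiteness of \<open>\<alpha>(t)\<close> follows by testing with a multiple of the indicator function of \<open>(t/2, t)\<close>.
  For the bound, let \<open>J\<close> be the integral of \<open>\<psi>(b(s)) s\<^bsup>1/p-1\<^esup>\<close> over \<open>(\<epsilon>, t)\<close>,
  which is finite because of the truncation at \<open>\<epsilon>\<close>, and test with \<open>g = \<psi>(b) / J\<close>, for which
  the integral is \<open>1\<close>. If \<open>J > C \<ge> K\<close>, then convexity extracts the factor \<open>K / J\<close> from
  \<open>\<Phi>2(K g)\<close>, and \<open>\<Phi>2(\<psi>(b)) \<le> b \<psi>(b)\<close> gives \<open>\<alpha>(t) \<le> K\<^sup>2 / C \<cdot> \<alpha>(t)\<close>. This is
  impossible for \<open>C > K\<^sup>2\<close>, hence \<open>J \<le> C\<close> for every \<open>\<epsilon>\<close>.\<close>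

lemma modular_inequality_imp_density:
  assumes M: "modular_inequality p \<gamma> \<Phi>1 \<Phi>2"
  shows "bloom_kerman_density p \<gamma> \<Phi>1 \<phi>"
proof -
  from M obtain K where K: "K > 0" and le: "\<And>f. f \<in> borel_measurable leb_pos \<Longrightarrow> \<forall>t>0. 0 \<le> f t \<Longrightarrow>
      modular \<Phi>1 \<gamma> (hardy_nn p f) \<le> ennreal K * modular \<Phi>2 \<gamma> (\<lambda>s. ennreal (K * f s))"
    unfolding modular_inequality_def measurable_Rplus_iff by blast
  have fin: "tail_alpha p \<gamma> \<Phi>1 t < \<infinity>" if t: "0 < t" for t
  proof -
    have t2: "0 < t / 2" "t / 2 \<le> t" using t by auto
    obtain m where m: "0 < m" "\<And>s. s \<in> {t/2..t} \<Longrightarrow> m \<le> s powr (1 / p - 1)"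
      using powr_bounds[OF t2, of "1 / p - 1"] by metis
    obtain W where W: "0 < W" "\<And>s. s \<in> {t/2..t} \<Longrightarrow> s powr \<gamma> \<le> W"
      using powr_bounds[OF t2, of \<gamma>] by metis
    define c where "c = 2 / (m * t)"
    have c: "c > 0" using m t by (simp add: c_def)
    define f where "f s = c * indicator {t/2<..<t} s" for s :: real
    have f[measurable]: "f \<in> borel_measurable leb_pos" unfolding f_def[abs_def] by measurable
    have S: "{t/2<..<t} \<in> sets leb_pos" "emeasure leb_pos {t/2<..<t} = ennreal (t / 2)"
      using t by (auto simp: emeasure_leb_pos_interval intro!: borel_set_leb_pos)
    have "1 = ennreal (c * m) * ennreal (t / 2)"
      using m t by (simp add: c_def ennreal_mult'[symmetric])
    also have "\<dots> = (\<integral>\<^sup>+s. ennreal (c * m) * indicator {t/2<..<t} s \<partial>leb_pos)"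
      using S by (subst nn_integral_cmult_indicator) auto
    also have "\<dots> \<le> hardy_integral p f t"
      unfolding hardy_integral_def f_def using t c m
      by (intro nn_integral_mono) (auto split: split_indicator intro!: ennreal_leI mult_left_mono)
    finally have "tail_alpha p \<gamma> \<Phi>1 t \<le> modular \<Phi>1 \<gamma> (hardy_nn p f)"
      by (rule tail_le_modular_hardy[OF t])
    also have "\<dots> \<le> ennreal K * modular \<Phi>2 \<gamma> (\<lambda>s. ennreal (K * f s))"
      using c by (intro le f) (auto simp: f_def)
    also have "modular \<Phi>2 \<gamma> (\<lambda>s. ennreal (K * f s)) \<le>
        (\<integral>\<^sup>+s. ennreal (\<Phi>2 (K * c) * W) * indicator {t/2<..<t} s \<partial>leb_pos)"
      unfolding modular_leb_pos
    proof (rule nn_integral_mono)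
      fix s
      have nn: "0 \<le> \<Phi>2 (K * c)"
        using K c by (simp add: \<Phi>2 primitive_nonneg[OF \<phi>_mono \<phi>_nonneg])
      show "extend_top \<Phi>2 (ennreal (K * f s)) * ennreal (s powr \<gamma>) \<le>
          ennreal (\<Phi>2 (K * c) * W) * indicator {t/2<..<t} s"
        using K c W(2)[of s] nn
        by (cases "s \<in> {t/2<..<t}")
          (auto simp: f_def extend_top_ennreal \<Phi>2_0 ennreal_mult''[symmetric] extend_top_def
            intro!: ennreal_leI mult_left_mono)
    qed
    also have "\<dots> = ennreal (\<Phi>2 (K * c) * W) * ennreal (t / 2)"
      using S by (subst nn_integral_cmult_indicator) auto
    finally show ?thesis by (auto simp: ennreal_mult_less_top mult_left_mono less_top[symmetric] top_unique ennreal_mult_eq_top_iff)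
  qed
  \<comment> \<open>\<open>C \<ge> K\<close> makes \<open>K / J \<le> 1\<close>, as convexity requires, and \<open>C > K\<^sup>2\<close> gives the contradiction.\<close>
  define C where "C = K\<^sup>2 + K + 1"
  have C: "C > 0" "K\<^sup>2 < C" "K \<le> C" using K by (auto simp: C_def add_pos_pos)
  have trunc: "(\<integral>\<^sup>+s\<in>{\<epsilon><..<t}. ennreal (\<psi> (slope C t s) * s powr (1 / p - 1)) \<partial>leb_pos) \<le> ennreal C"
    if \<epsilon>: "0 < \<epsilon>" "\<epsilon> < t" for \<epsilon> t
  proof (rule ccontr)
    assume neg: "\<not> ?thesis"
    have t: "0 < t" using \<epsilon> by simp
    note a = tail_pos[OF t fin[OF t]]
    note inverse_slope_measurable[OF a(1) C(1), measurable]
    define J where "J = (\<integral>\<^sup>+s\<in>{\<epsilon><..<t}. ennreal (\<psi> (slope C t s) * s powr (1 / p - 1)) \<partial>leb_pos)"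
    have S: "{\<epsilon><..<t} \<in> sets leb_pos" "emeasure leb_pos {\<epsilon><..<t} = ennreal (t - \<epsilon>)"
      using \<epsilon> by (auto simp: emeasure_leb_pos_interval intro!: borel_set_leb_pos)
    obtain m where m: "0 < m" "\<And>s. s \<in> {\<epsilon>..t} \<Longrightarrow> m \<le> s powr (1 - 1 / p + \<gamma>)"
      using powr_bounds[OF \<epsilon>(1) less_imp_le[OF \<epsilon>(2)], of "1 - 1 / p + \<gamma>"] by metis
    obtain W where W: "0 < W" "\<And>s. s \<in> {\<epsilon>..t} \<Longrightarrow> s powr (1 / p - 1) \<le> W"
      using powr_bounds[OF \<epsilon>(1) less_imp_le[OF \<epsilon>(2)], of "1 / p - 1"] by metis
    define B where "B = \<psi> (\<alpha> t / (C * m))"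
    have "J \<le> (\<integral>\<^sup>+s. ennreal (B * W) * indicator {\<epsilon><..<t} s \<partial>leb_pos)"
      unfolding J_def
    proof (rule nn_integral_mono)
      fix s
      have "\<psi> (slope C t s) * s powr (1 / p - 1) \<le> B * W" if s: "s \<in> {\<epsilon><..<t}"
      proof (rule mult_mono)
        have "slope C t s \<le> \<alpha> t / (C * m)"
          unfolding slope_def using a(1) C m(1) m(2)[of s] s \<epsilon>
          by (intro divide_left_mono mult_left_mono) auto
        moreover have "0 < slope C t s" using slope_pos[OF a(1) C(1), of s] s \<epsilon> by simp
        ultimately show "\<psi> (slope C t s) \<le> B"
          unfolding B_def by (intro mono_onD[OF generalized_inverse_mono[OF young]]) auto
        show "0 \<le> B" unfolding B_def
          using a(1) C m by (intro generalized_inverse_nonneg[OF young]) simp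
      qed (use W s in auto)
      then show "ennreal (\<psi> (slope C t s) * s powr (1 / p - 1)) * indicator {\<epsilon><..<t} s \<le>
          ennreal (B * W) * indicator {\<epsilon><..<t} s"
        by (auto split: split_indicator intro: ennreal_leI)
    qed
    also have "\<dots> = ennreal (B * W) * ennreal (t - \<epsilon>)"
      using S by (subst nn_integral_cmult_indicator) auto
    also have "\<dots> < \<infinity>" by (simp add: ennreal_mult_less_top)
    finally obtain j where j: "J = ennreal j" "0 \<le> j" by (cases J rule: ennreal_cases) auto
    have jC: "C < j" using neg j C(1) by (simp add: J_def[symmetric] ennreal_less_iff not_le)
    then have j0: "0 < j" using C by simp
    define g where "g s = 1 / j * (\<psi> (slope C t s) * indicator {\<epsilon><..<t} s)" for s
    have g[measurable]: "g \<in> borel_measurable leb_pos" unfolding g_def[abs_def] by measurable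
    have \<psi>_nn: "0 \<le> \<psi> (slope C t s)" if "0 < s" for s
      using generalized_inverse_nonneg[OF young slope_pos[OF a(1) C(1) that]] .
    have g_nn: "\<forall>s>0. 0 \<le> g s" using \<psi>_nn j0 by (simp add: g_def)
    have "hardy_integral p (\<lambda>s. \<psi> (slope C t s) * indicator {\<epsilon><..<t} s) t = J"
      unfolding hardy_integral_def J_def using \<epsilon> by (intro nn_integral_cong) (auto split: split_indicator)
    then have "hardy_integral p g t = ennreal (1 / j) * J"
      unfolding g_def[abs_def] using j0 by (subst hardy_integral_cmult) auto
    also have "\<dots> = 1" using j j0 by (simp add: ennreal_mult'[symmetric])
    finally have "tail_alpha p \<gamma> \<Phi>1 t \<le> modular \<Phi>1 \<gamma> (hardy_nn p g)"
      by (intro tail_le_modular_hardy t) simp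
    also have "\<dots> \<le> ennreal K * modular \<Phi>2 \<gamma> (\<lambda>s. ennreal (K * g s))"
      by (intro le g g_nn)
    also have "modular \<Phi>2 \<gamma> (\<lambda>s. ennreal (K * g s)) \<le>
        (\<integral>\<^sup>+s. ennreal (K / j * (\<alpha> t / C)) *
          (ennreal (\<psi> (slope C t s) * s powr (1 / p - 1)) * indicator {\<epsilon><..<t} s) \<partial>leb_pos)"
      unfolding modular_leb_pos
    proof (rule nn_integral_mono)
      fix s assume "s \<in> space leb_pos"
      then have s: "0 < s" by (simp add: space_restrict_space)
      show "extend_top \<Phi>2 (ennreal (K * g s)) * ennreal (s powr \<gamma>) \<le> ennreal (K / j * (\<alpha> t / C)) *
          (ennreal (\<psi> (slope C t s) * s powr (1 / p - 1)) * indicator {\<epsilon><..<t} s)"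
      proof (cases "s \<in> {\<epsilon><..<t}")
        case True
        define b where "b = slope C t s"
        have b: "0 < b" using slope_pos[OF a(1) C(1) s] by (simp add: b_def)
        have "K * g s = K / j * \<psi> b" using True by (simp add: g_def b_def)
        then have "\<Phi>2 (K * g s) = primitive \<phi> (K / j * \<psi> b)"
          using K j0 generalized_inverse_nonneg[OF young b] by (simp add: \<Phi>2)
        also have "\<dots> \<le> K / j * primitive \<phi> (\<psi> b)"
          using K j0 jC C generalized_inverse_nonneg[OF young b]
          by (intro primitive_scale[OF \<phi>_mono \<phi>_nonneg]) auto
        also have "\<dots> \<le> K / j * (b * \<psi> b)"
          using K j0 by (intro mult_left_mono primitive_at_inverse[OF young b]) auto
        finally have "\<Phi>2 (K * g s) * s powr \<gamma> \<le> K / j * (b * \<psi> b) * s powr \<gamma>"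
          by (rule mult_right_mono) simp
        also have "\<dots> = K / j * \<psi> b * (b * s powr \<gamma>)" by (simp add: mult_ac)
        also have "\<dots> = K / j * (\<alpha> t / C) * (\<psi> b * s powr (1 / p - 1))"
          unfolding b_def slope_weight[OF s] by (simp add: mult_ac)
        finally have "ennreal (\<Phi>2 (K * g s) * s powr \<gamma>) \<le>
            ennreal (K / j * (\<alpha> t / C) * (\<psi> b * s powr (1 / p - 1)))"
          by (rule ennreal_leI)
        moreover have "0 \<le> K / j * (\<alpha> t / C)" using K j0 a(1) C by simp
        moreover have "0 \<le> K * g s" using K g_nn s by simp
        ultimately show ?thesis using True
          by (simp add: extend_top_ennreal ennreal_mult''[symmetric] ennreal_mult'[symmetric] b_def)
      next
        case False
        then show ?thesis by (simp add: g_def extend_top_def \<Phi>2_0)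
      qed
    qed
    also have "\<dots> = ennreal (K / j * (\<alpha> t / C)) * J"
      unfolding J_def by (rule nn_integral_cmult) measurable
    finally have "ennreal (\<alpha> t) \<le> ennreal K * (ennreal (K / j * (\<alpha> t / C)) * ennreal j)"
      using a(2) j by (simp add: mult_left_mono)
    also have "\<dots> = ennreal (K * (K / j * (\<alpha> t / C) * j))"
      using K j0 a(1) C by (simp only: ennreal_mult' mult_nonneg_nonneg divide_nonneg_nonneg less_imp_le)
    finally have "\<alpha> t \<le> K * (K / j * (\<alpha> t / C) * j)"
      using K j0 a(1) C by (subst (asm) ennreal_le_iff) auto
    also have "\<dots> = K\<^sup>2 / C * \<alpha> t" using j0 by (simp add: power2_eq_square)
    also have "\<dots> < 1 * \<alpha> t" using a(1) C by (intro mult_strict_right_mono) auto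
    finally show False by simp
  qed
  have "inverse_integral C t \<le> ennreal C" if t: "0 < t" for t
  proof -
    note a = tail_pos[OF t fin[OF t]]
    note inverse_slope_measurable[OF a(1) C(1), measurable]
    define h where "h s = ennreal (\<psi> (slope C t s) * s powr (1 / p - 1))" for s
    have [measurable]: "h \<in> borel_measurable leb_pos" unfolding h_def[abs_def] by measurable
    have "(\<lambda>n. \<integral>\<^sup>+s\<in>{t / (real n + 2)<..<t}. h s \<partial>leb_pos) \<longlonglongrightarrow> (\<integral>\<^sup>+s\<in>{0<..<t}. h s \<partial>leb_pos)"
    proof (rule nn_integral_LIMSEQ)
      show "incseq (\<lambda>n s. h s * indicator {t / (real n + 2)<..<t} s)"
      proof (intro monoI le_funI)
        fix i j :: nat and s :: real assume "i \<le> j"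
        then have "t / (real j + 2) \<le> t / (real i + 2)" using t by (intro divide_left_mono) auto
        then show "h s * indicator {t / (real i + 2)<..<t} s \<le> h s * indicator {t / (real j + 2)<..<t} s"
          by (auto split: split_indicator)
      qed
      show "(\<lambda>s. h s * indicator {t / (real n + 2)<..<t} s) \<in> borel_measurable leb_pos" for n
        by measurable
      show "(\<lambda>n. h s * indicator {t / (real n + 2)<..<t} s) \<longlonglongrightarrow> h s * indicator {0<..<t} s" for s
      proof (cases "0 < s")
        case True
        have "(\<lambda>n. t / (real n + 2)) \<longlonglongrightarrow> 0" by real_asymp
        then have "eventually (\<lambda>n. t / (real n + 2) < s) sequentially"
          using True by (rule order_tendstoD)
        then have "eventually (\<lambda>n. h s * indicator {t / (real n + 2)<..<t} s = h s * indicator {0<..<t} s) sequentially"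
          by eventually_elim (use True in \<open>auto split: split_indicator\<close>)
        then show ?thesis by (rule tendsto_eventually)
      next
        case False
        then have "\<not> t / (real n + 2) < s" for n
          using t by (auto simp: not_less intro: order_trans[of s 0])
        then show ?thesis using False by simp
      qed
    qed
    moreover have "(\<integral>\<^sup>+s\<in>{t / (real n + 2)<..<t}. h s \<partial>leb_pos) \<le> ennreal C" for n
      unfolding h_def
    proof (rule trunc)
      show "0 < t / (real n + 2)" using t by simp
      have "t / (real n + 2) < t / 1" using t by (intro divide_strict_left_mono) auto
      then show "t / (real n + 2) < t" by simp
    qed
    ultimately show ?thesis unfolding inverse_integral_def h_def by (intro LIMSEQ_le_const2) auto
  qed
  then show ?thesis unfolding bloom_kerman_density_iff using C(1) fin by blast
qed

end

theorem theorem2: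
  fixes p \<gamma> :: real and \<Phi>1 \<Phi>2 :: "real \<Rightarrow> real"
  assumes "p \<noteq> 0" and "\<gamma> \<noteq> -1" and "\<gamma> + 1 - 1 / p \<noteq> 0"
    and "growth_function \<Phi>1"
  shows "(growth_function \<Phi>2 \<longrightarrow>
      (gauge_inequality p \<gamma> \<Phi>1 \<Phi>2 \<longleftrightarrow> modular_inequality p \<gamma> \<Phi>1 \<Phi>2)) \<and>
    (\<forall>s. growth_function \<Phi>2 \<longrightarrow> 0 < s \<longrightarrow> s \<le> 1 \<longrightarrow> s_convex s \<Phi>1 \<longrightarrow> s_convex s \<Phi>2 \<longrightarrow>
      (gauge_inequality p \<gamma> \<Phi>1 \<Phi>2 \<longleftrightarrow> hardy_maps_continuously s p \<gamma> \<Phi>1 \<Phi>2) \<and>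
      (modular_inequality p \<gamma> \<Phi>1 \<Phi>2 \<longleftrightarrow> hardy_maps_continuously s p \<gamma> \<Phi>1 \<Phi>2)) \<and>
    (\<forall>\<phi>2. young_function \<phi>2 \<Phi>2 \<longrightarrow>
      (gauge_inequality p \<gamma> \<Phi>1 \<Phi>2 \<longleftrightarrow> modular_inequality p \<gamma> \<Phi>1 \<Phi>2) \<and>
      (gauge_inequality p \<gamma> \<Phi>1 \<Phi>2 \<longleftrightarrow> bloom_kerman p \<gamma> \<Phi>1 \<phi>2) \<and>
      (modular_inequality p \<gamma> \<Phi>1 \<Phi>2 \<longleftrightarrow> bloom_kerman p \<gamma> \<Phi>1 \<phi>2) \<and>
      (bloom_kerman p \<gamma> \<Phi>1 \<phi>2 \<longleftrightarrow> bloom_kerman_density p \<gamma> \<Phi>1 \<phi>2))"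
proof -
  note mono1 = growth_function_mono(1)[OF assms(4)]
  have GM: "gauge_inequality p \<gamma> \<Phi>1 \<Phi>2 \<longleftrightarrow> modular_inequality p \<gamma> \<Phi>1 \<Phi>2" if "mono_on {0..} \<Phi>2"
    using gauge_inequality_imp_modular_inequality[OF assms(2) mono1 that]
      modular_inequality_imp_gauge_inequality[OF mono1 that] by blast
  have MI: "modular_inequality p \<gamma> \<Phi>1 \<Phi>2 \<longleftrightarrow> hardy_maps_continuously s p \<gamma> \<Phi>1 \<Phi>2"
    if "growth_function \<Phi>2" "0 < s" "s_convex s \<Phi>1" for s
    using modular_inequality_imp_continuous[OF assms(4) that(2,3)]
      continuous_imp_modular_inequality[OF assms(2,4) that(1,2)] by blast
  have MB: "mono_on {0..} \<Phi>2 \<and>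
      (modular_inequality p \<gamma> \<Phi>1 \<Phi>2 \<longleftrightarrow> bloom_kerman_density p \<gamma> \<Phi>1 \<phi>2) \<and>
      (bloom_kerman p \<gamma> \<Phi>1 \<phi>2 \<longleftrightarrow> bloom_kerman_density p \<gamma> \<Phi>1 \<phi>2)"
    if "young_function \<phi>2 \<Phi>2" for \<phi>2
  proof -
    interpret hardy_young p \<gamma> \<Phi>1 \<Phi>2 \<phi>2
      using assms(4) that by unfold_locales (auto simp: young_function_def)
    show ?thesis
      using \<Phi>2_mono bloom_kerman_iff_density modular_inequality_imp_density
        density_imp_modular_inequality[OF assms(1)] by blast
  qed
  have "growth_function \<Phi>2 \<longrightarrow> (gauge_inequality p \<gamma> \<Phi>1 \<Phi>2 \<longleftrightarrow> modular_inequality p \<gamma> \<Phi>1 \<Phi>2)"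
    using GM[OF growth_function_mono(1)] by blast
  moreover have "\<forall>s. growth_function \<Phi>2 \<longrightarrow> 0 < s \<longrightarrow> s \<le> 1 \<longrightarrow> s_convex s \<Phi>1 \<longrightarrow> s_convex s \<Phi>2 \<longrightarrow>
      (gauge_inequality p \<gamma> \<Phi>1 \<Phi>2 \<longleftrightarrow> hardy_maps_continuously s p \<gamma> \<Phi>1 \<Phi>2) \<and>
      (modular_inequality p \<gamma> \<Phi>1 \<Phi>2 \<longleftrightarrow> hardy_maps_continuously s p \<gamma> \<Phi>1 \<Phi>2)"
    by (simp add: GM[OF growth_function_mono(1)] MI)
  moreover have "\<forall>\<phi>2. young_function \<phi>2 \<Phi>2 \<longrightarrow>
      (gauge_inequality p \<gamma> \<Phi>1 \<Phi>2 \<longleftrightarrow> modular_inequality p \<gamma> \<Phi>1 \<Phi>2) \<and>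
      (gauge_inequality p \<gamma> \<Phi>1 \<Phi>2 \<longleftrightarrow> bloom_kerman p \<gamma> \<Phi>1 \<phi>2) \<and>
      (modular_inequality p \<gamma> \<Phi>1 \<Phi>2 \<longleftrightarrow> bloom_kerman p \<gamma> \<Phi>1 \<phi>2) \<and>
      (bloom_kerman p \<gamma> \<Phi>1 \<phi>2 \<longleftrightarrow> bloom_kerman_density p \<gamma> \<Phi>1 \<phi>2)"
    using MB by (simp add: GM)
  ultimately show ?thesis by (intro conjI)
qed

end
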